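(* Let $(\mathcal Q,d)$ be a Hadamard space satisfying the entropy condition $$\exists s\in(0,2)\colon\quad\limsup_{R\to0}\;\sup_{q\in\mathcal Q}\;\sup_{r\in(0,R)}\;r^sR^{-s}\log\big(N(\overline{\mathrm B}(q,R),r)\big)<\infty.$$ Let $\alpha\in(1,2]$. Let $Y$ be a $\mathcal Q$-valued random variable concentrated on a separable set with $\mathbf E[d(Y,o)^{\alpha-1}]<\infty$, let $m$ be its $\alpha$-Fréchet mean, and let $m_n$ be the empirical $\alpha$-Fréchet mean of $n$ independent copies $Y_1,\dots,Y_n$ of $Y$. Assume $\sigma_{2\alpha-2}:=\mathbf E[d(Y,m)^{2\alpha-2}]<\infty$. Set $\beta:=2$, or let $\beta\in[\alpha,2)$ and assume $$\liminf_{t\to0}\;t^{\alpha-\beta}\,\mathbf P(d(Y,m)\le t)>0.$$ Then $$d(m,m_n)=O_{\mathbf P}\Big(n^{-\frac1{2(\beta-1)}}\Big).$$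
   Context: A Hadamard space is a nonempty complete metric space $(\mathcal Q,d)$ such that for all $y_0,y_1\in\mathcal Q$ there is $p\in\mathcal Q$ with $\frac12 d(y_0,q)^2+\frac12 d(y_1,q)^2-\frac14 d(y_0,y_1)^2\ge d(q,p)^2$ for all $q\in\mathcal Q$; it carries its Borel $\sigma$-algebra. "Concentrated on a separable set" means $\mathbf P(Y\in\mathcal Y)=1$ for some separable $\mathcal Y\subset\mathcal Q$. $\overline{\mathrm B}(q,R)$ is the closed ball. For $B\subset\mathcal Q$, $N(B,r):=\min\{k\in\mathbb N:\exists q_1,\dots,q_k\in\mathcal Q,\;B\subset\bigcup_{\ell=1}^k\overline{\mathrm B}(q_\ell,r)\}$ is the covering number. The $\alpha$-Fréchet mean is the unique $m=\arg\min_{q\in\mathcal Q}\mathbf E[d(Y,q)^\alpha-d(Y,o)^\alpha]$ with an arbitrary reference point $o\in\mathcal Q$ (independent of $o$), and $m_n=\arg\min_{q\in\mathcal Q}\sum_{j=1}^n d(Y_j,q)^\alpha$, regarded as a measurable function of $(Y_1,\dots,Y_n)$. For nonnegative random variables $X_n$ and $a_n>0$, $X_n=O_{\mathbf P}(a_n)$ means $\lim_{t\to\infty}\limsup_{n\to\infty}\mathbf P(X_n>t\,a_n)=0$. *)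

theory Defs
  imports "HOL-Probability.Probability"
begin

class hadamard_space = complete_space +
  assumes hadamard_midpoint:
    "\<exists>p. \<forall>q. 1/2 * (dist y0 q)\<^sup>2 + 1/2 * (dist y1 q)\<^sup>2 - 1/4 * (dist y0 y1)\<^sup>2 \<ge> (dist q p)\<^sup>2"

text \<open>
  The covering number is \<open>\<infinity>\<close> (the infimum of the empty set in \<^typ>\<open>enat\<close>) if no finite
  cover exists. The centres are arbitrary points of the space and need not lie in \<open>B\<close>.
\<close>
definition covering_number :: "'a::metric_space set \<Rightarrow> real \<Rightarrow> enat" where
  "covering_number B r =
     Inf {enat k | k. \<exists>q :: nat \<Rightarrow> 'a. B \<subseteq> (\<Union>l\<in>{1..k}. cball (q l) r)}"

text \<open>
  Only used for covering numbers of nonempty sets, so the value at \<open>0\<close> is irrelevant.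
\<close>
definition ln_enat :: "enat \<Rightarrow> ereal" where
  "ln_enat N = (case N of enat k \<Rightarrow> ereal (ln (real k)) | \<infinity> \<Rightarrow> \<infinity>)"

definition entropy_condition :: "'a::metric_space itself \<Rightarrow> bool" where
  "entropy_condition _ \<longleftrightarrow>
     (\<exists>s\<in>{0<..<2 :: real}.
        Limsup (at_right 0) (\<lambda>R. SUP q :: 'a. SUP r\<in>{0<..<R}.
          ereal (r powr s * R powr (- s)) * ln_enat (covering_number (cball q R) r)) < \<infinity>)"

definition concentrated_on_separable :: "'w measure \<Rightarrow> ('w \<Rightarrow> 'a::topological_space) \<Rightarrow> bool" where
  "concentrated_on_separable M Y \<longleftrightarrow>
     (\<exists>S. separable_space (top_of_set S) \<and> measure M {\<omega>\<in>space M. Y \<omega> \<in> S} = 1)"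

text \<open>
  The integrand is Bochner integrable for every \<open>q\<close> as soon as \<open>d(Y, z)\<^sup>\<alpha>\<^sup>-\<^sup>1\<close> is integrable,
  because \<open>\<bar>a\<^sup>\<alpha> - b\<^sup>\<alpha>\<bar> \<le> \<alpha> \<bar>a - b\<bar> max(a, b)\<^sup>\<alpha>\<^sup>-\<^sup>1\<close>. The point \<open>z\<close> is the reference point.
\<close>
definition is_frechet_mean ::
    "real \<Rightarrow> 'w measure \<Rightarrow> ('w \<Rightarrow> 'a::metric_space) \<Rightarrow> 'a \<Rightarrow> 'a \<Rightarrow> bool" where
  "is_frechet_mean \<alpha> M Y z m \<longleftrightarrow>
     is_arg_min (\<lambda>q. \<integral>\<omega>. (dist (Y \<omega>) q powr \<alpha> - dist (Y \<omega>) z powr \<alpha>) \<partial>M) (\<lambda>_. True) m"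

definition is_empirical_frechet_mean ::
    "real \<Rightarrow> nat \<Rightarrow> (nat \<Rightarrow> 'a::metric_space) \<Rightarrow> 'a \<Rightarrow> bool" where
  "is_empirical_frechet_mean \<alpha> n y m \<longleftrightarrow>
     is_arg_min (\<lambda>q. \<Sum>j=1..n. dist (y j) q powr \<alpha>) (\<lambda>_. True) m"

definition bigO_prob :: "'w measure \<Rightarrow> (nat \<Rightarrow> 'w \<Rightarrow> real) \<Rightarrow> (nat \<Rightarrow> real) \<Rightarrow> bool" where
  "bigO_prob M X a \<longleftrightarrow>
     ((\<lambda>t. limsup (\<lambda>n. ereal (measure M {\<omega>\<in>space M. X n \<omega> > t * a n}))) \<longlongrightarrow> 0) at_top"

end

theory Submission
  imports Defs
begin

text \<open>
  Write \<open>f\<^sub>q(y) = d(y,q)\<^sup>\<alpha> - d(y,m)\<^sup>\<alpha>\<close>. The rate comes from comparing two bounds at distance \<open>\<rho>\<close> from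
  \<open>m\<close>: a lower bound \<open>c \<rho>\<^sup>\<beta>\<close> for \<open>E f\<^sub>q(Y)\<close>, and an upper bound \<open>K \<rho> / \<surd>n\<close>, uniform in \<open>q\<close> and
  valid with high probability, for \<open>E f\<^sub>q(Y) - 1/n \<Sum>\<^sub>j f\<^sub>q(Y\<^sub>j)\<close>. If some \<open>q\<close> at that distance does at
  least as well as \<open>m\<close> on the sample, then \<open>c \<rho>\<^sup>\<beta> \<le> K \<rho> / \<surd>n\<close> up to a constant, and this fails for
  \<open>\<rho> = t * n powr (- 1 / (2 * (\<beta> - 1)))\<close> with \<open>t\<close> large.

  \<^emph>\<open>Localisation.\<close> In a Hadamard space the distance to the midpoint of \<open>x\<close> and \<open>y\<close> is at most the
  mean of the distances to \<open>x\<close> and \<open>y\<close>, so the empirical objective is midpoint convex. Halving the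
  segment from \<open>m\<close> to a far away minimiser repeatedly produces a point with distance to \<open>m\<close> in
  \<open>(\<rho>/2, \<rho>]\<close> where the objective is still at most its value at \<open>m\<close> (\<open>midpoint_convex_localize\<close>).
  This leaves a single small scale \<open>\<rho>\<close> to treat, on which the entropy condition applies, and rules out
  distant minimisers at the same time as close ones.

  \<^emph>\<open>Lower bound.\<close> The midpoint inequality is in fact strict by a multiple of
  \<open>d(x,y)\<^sup>2 (d(q,x) + d(x,y))\<^sup>\<alpha>\<^sup>-\<^sup>2\<close> (\<open>powr_dist_midpoint_le\<close>). Applied to \<open>m\<close> and \<open>q\<close>, and combined
  with the optimality of \<open>m\<close> against the midpoint, it bounds \<open>E f\<^sub>q(Y)\<close> below
  (\<open>frechet_mean_variance_inequality\<close>); the small ball assumption turns this into \<open>c d(m,q)\<^sup>\<beta>\<close>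
  (\<open>frechet_mean_growth\<close>).

  \<^emph>\<open>Upper bound.\<close> The maps \<open>q \<mapsto> f\<^sub>q(y)\<close> are Lipschitz near \<open>m\<close> with a constant \<open>F(y)\<close> that is merely
  square integrable, so increments of the empirical process may lack exponential moments. But
  \<open>exp (x - x\<^sup>2/6) \<le> 1 + x + x\<^sup>2/3\<close> yields a sub-Gaussian tail for every sum of independent centred
  variables on the event that its sum of squares is bounded (\<open>self_normalized_tail_bound\<close>). One
  event, that \<open>\<Sum>\<^sub>j G(Y\<^sub>j)\<^sup>2\<close> is of order \<open>n\<close>, where \<open>G = F + E F(Y)\<close>, serves all increments at once. On
  it the usual chaining along nets of radius \<open>\<rho> 2\<^sup>-\<^sup>k\<close> works with a union bound
  (\<open>chaining_tail_bound\<close>), and the entropy exponent \<open>s < 2\<close> makes the sum over \<open>k\<close> finite.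
\<close>

section \<open>Self-normalised tail bounds\<close>

text \<open>
  The difference \<open>ln (1 + x + x\<^sup>2/3) - (x - x\<^sup>2/6)\<close> vanishes at \<open>0\<close>, and its derivative is \<open>x\<^sup>3/9\<close> divided
  by a positive quadratic polynomial, so \<open>0\<close> is its minimum. Subtracting \<open>x\<^sup>2/6\<close> in the exponent is what
  makes the left-hand side bounded in \<open>x\<close>.
\<close>

lemma exp_minus_square_le:
  fixes x :: real
  shows "exp (x - x\<^sup>2 / 6) \<le> 1 + x + x\<^sup>2 / 3"
proof -
  define q where "q x = 1 + x + x\<^sup>2 / 3" for x :: real
  define g where "g x = ln (q x) - x + x\<^sup>2 / 6" for x :: real
  have q_pos: "q x > 0" for x
  proof -
    have "q x = (x / 2 + 1)\<^sup>2 + x\<^sup>2 / 12"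
      by (simp add: q_def power2_eq_square field_simps)
    moreover have "\<dots> > 0"
      by (cases "x = 0") (auto intro: add_nonneg_pos)
    ultimately show ?thesis by simp
  qed
  have deriv: "(g has_real_derivative x ^ 3 / 9 / q x) (at x)" for x
  proof -
    have "(g has_real_derivative (1 + 2 * x / 3) / q x - 1 + x / 3) (at x)"
      unfolding g_def [abs_def] using q_pos [of x] unfolding q_def
      by (auto intro!: derivative_eq_intros simp: field_simps)
    moreover have "(1 + 2 * x / 3) / q x - 1 + x / 3 = x ^ 3 / 9 / q x"
      using q_pos [of x] by (simp add: q_def divide_simps) (simp add: algebra_simps power2_eq_square power3_eq_cube)
    ultimately show ?thesis by simp
  qed
  have "g 0 \<le> g x"
  proof (cases "0 \<le> x")
    case True
    show ?thesis
      by (rule DERIV_nonneg_imp_nondecreasing [OF True])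
        (use deriv q_pos in \<open>auto intro!: exI divide_nonneg_pos\<close>)
  next
    case False
    show ?thesis
    proof (rule DERIV_nonpos_imp_nonincreasing [of x 0])
      show "\<exists>y'. (g has_real_derivative y') (at y) \<and> y' \<le> 0" if "x \<le> y" "y \<le> 0" for y
      proof -
        have "y ^ 3 \<le> 0" using that by (simp add: power_le_zero_eq)
        then have "y ^ 3 / 9 / q y \<le> 0" using q_pos [of y] by (intro divide_nonpos_pos) auto
        then show ?thesis using deriv by blast
      qed
    qed (use False in auto)
  qed
  then have "x - x\<^sup>2 / 6 \<le> ln (q x)" by (simp add: g_def q_def)
  then show ?thesis using q_pos [of x] by (simp add: ln_ge_iff q_def)
qed

context prob_space
begin

text \<open>
  Chernoff's method, with the random variance proxy \<open>V = \<Sum>\<^sub>i (Z\<^sub>i\<^sup>2/6 + E Z\<^sub>i\<^sup>2/3)\<close> inside the exponent: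
  \<open>exp_minus_square_le\<close> gives \<open>E exp (l Z - l\<^sup>2 (Z\<^sup>2/6 + E Z\<^sup>2/3)) \<le> 1\<close> for each centred summand, so by
  independence \<open>E exp (l \<Sum>\<^sub>i Z\<^sub>i - l\<^sup>2 V) \<le> 1\<close>, and Markov's inequality finishes the proof. Second moments
  suffice because the bound is only claimed on the event \<open>V \<le> v\<close>.
\<close>

lemma self_normalized_tail_bound:
  fixes Z :: "'i \<Rightarrow> 'a \<Rightarrow> real"
  assumes I: "finite I" and indep: "indep_vars (\<lambda>_. borel) Z I"
    and square: "\<And>i. i \<in> I \<Longrightarrow> integrable M (\<lambda>\<omega>. (Z i \<omega>)\<^sup>2)"
    and centred: "\<And>i. i \<in> I \<Longrightarrow> expectation (Z i) = 0"
    and u: "0 \<le> u" and v: "0 < v"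
  shows "prob {\<omega> \<in> space M. u \<le> (\<Sum>i\<in>I. Z i \<omega>) \<and>
      (\<Sum>i\<in>I. (Z i \<omega>)\<^sup>2 / 6 + expectation (\<lambda>\<omega>. (Z i \<omega>)\<^sup>2) / 3) \<le> v} \<le> exp (- u\<^sup>2 / (4 * v))"
    (is "prob ?A \<le> _")
proof -
  \<comment> \<open>the maximiser of \<open>l u - l\<^sup>2 v\<close>\<close>
  define l where "l = u / (2 * v)"
  define s where "s i = expectation (\<lambda>\<omega>. (Z i \<omega>)\<^sup>2)" for i
  define h where "h i x = l * x - l\<^sup>2 * (x\<^sup>2 / 6 + s i / 3)" for i and x :: real
  have Z [measurable]: "Z i \<in> borel_measurable M" if "i \<in> I" for i
    using indep that by (auto simp: indep_vars_def)
  have Z_int: "integrable M (Z i)" if "i \<in> I" for i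
    using square_integrable_imp_integrable [OF Z square] that by auto
  have h_meas [measurable]: "h i \<in> borel_measurable borel" for i
    unfolding h_def by measurable
  have one: "(\<integral>\<^sup>+\<omega>. ennreal (exp (h i (Z i \<omega>))) \<partial>M) \<le> 1" if i: "i \<in> I" for i
  proof -
    note [measurable] = Z [OF i]
    note int = Z_int [OF i] square [OF i]
    let ?r = "\<lambda>\<omega>. exp (- l\<^sup>2 * s i / 3) * (1 + l * Z i \<omega> + l\<^sup>2 * (Z i \<omega>)\<^sup>2 / 3)"
    have le: "exp (h i x) \<le> exp (- l\<^sup>2 * s i / 3) * (1 + l * x + l\<^sup>2 * x\<^sup>2 / 3)" for x
    proof -
      have "exp (h i x) = exp (- l\<^sup>2 * s i / 3) * exp (l * x - (l * x)\<^sup>2 / 6)"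
        by (simp add: h_def exp_add [symmetric] power_mult_distrib algebra_simps)
      also have "\<dots> \<le> exp (- l\<^sup>2 * s i / 3) * (1 + l * x + (l * x)\<^sup>2 / 3)"
        by (intro mult_left_mono exp_minus_square_le) auto
      finally show ?thesis by (simp add: power_mult_distrib)
    qed
    have "(\<integral>\<^sup>+\<omega>. ennreal (exp (h i (Z i \<omega>))) \<partial>M) \<le> (\<integral>\<^sup>+\<omega>. ennreal (?r \<omega>) \<partial>M)"
      by (intro nn_integral_mono ennreal_leI le)
    also have "\<dots> = ennreal (expectation ?r)"
    proof (intro nn_integral_eq_integral)
      show "integrable M ?r" using int by auto
      show "AE \<omega> in M. 0 \<le> ?r \<omega>"
        by (intro always_eventually allI order_trans [OF _ le]) simp
    qed
    also have "\<dots> \<le> 1"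
    proof -
      have "expectation ?r = exp (- (l\<^sup>2 * s i / 3)) * (1 + l\<^sup>2 * s i / 3)"
        using int centred [OF i] by (simp add: s_def prob_space)
      also have "\<dots> \<le> exp (- (l\<^sup>2 * s i / 3)) * exp (l\<^sup>2 * s i / 3)"
        by (intro mult_mono) (auto simp: s_def)
      also have "\<dots> = 1" by (simp add: exp_add [symmetric])
      finally show ?thesis by simp
    qed
    finally show ?thesis .
  qed
  have "indep_vars (\<lambda>_. borel) (\<lambda>i \<omega>. ennreal (exp (h i (Z i \<omega>)))) I"
    by (rule indep_vars_compose2 [OF indep, where Y = "\<lambda>i x. ennreal (exp (h i x))"]) measurable
  then have prod: "(\<integral>\<^sup>+\<omega>. (\<Prod>i\<in>I. ennreal (exp (h i (Z i \<omega>)))) \<partial>M)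
      = (\<Prod>i\<in>I. \<integral>\<^sup>+\<omega>. ennreal (exp (h i (Z i \<omega>))) \<partial>M)"
    by (rule indep_vars_nn_integral [OF I]) simp
  have "emeasure M ?A \<le> emeasure M {\<omega> \<in> space M. 1 \<le> ennreal (exp (- u\<^sup>2 / (4 * v))) *
        (\<Prod>i\<in>I. ennreal (exp (h i (Z i \<omega>))))}"
  proof (rule emeasure_mono; (rule subsetI)?)
    fix \<omega> assume w: "\<omega> \<in> ?A"
    have "l * u - l\<^sup>2 * v \<le> l * (\<Sum>i\<in>I. Z i \<omega>) - l\<^sup>2 * (\<Sum>i\<in>I. (Z i \<omega>)\<^sup>2 / 6 + s i / 3)"
      using w u v by (intro diff_mono mult_left_mono) (auto simp: l_def s_def)
    also have "\<dots> = (\<Sum>i\<in>I. h i (Z i \<omega>))"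
      by (simp add: h_def sum_subtractf sum_distrib_left)
    also have "l * u - l\<^sup>2 * v = u\<^sup>2 / (4 * v)"
      using v by (simp add: l_def field_simps power2_eq_square)
    finally have "exp (u\<^sup>2 / (4 * v)) \<le> (\<Prod>i\<in>I. exp (h i (Z i \<omega>)))"
      by (simp add: exp_sum [OF I, symmetric])
    then have "1 \<le> exp (- u\<^sup>2 / (4 * v)) * (\<Prod>i\<in>I. exp (h i (Z i \<omega>)))"
      by (simp add: exp_minus field_simps)
    then have "ennreal 1 \<le> ennreal (exp (- u\<^sup>2 / (4 * v)) * (\<Prod>i\<in>I. exp (h i (Z i \<omega>))))"
      by (rule ennreal_leI)
    then show "\<omega> \<in> {\<omega> \<in> space M. 1 \<le> ennreal (exp (- u\<^sup>2 / (4 * v))) *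
        (\<Prod>i\<in>I. ennreal (exp (h i (Z i \<omega>))))}"
      using w by (simp add: ennreal_mult prod_ennreal prod_nonneg)
  qed measurable
  also have "\<dots> \<le> ennreal (exp (- u\<^sup>2 / (4 * v))) *
      (\<integral>\<^sup>+\<omega>. (\<Prod>i\<in>I. ennreal (exp (h i (Z i \<omega>)))) * indicator (space M) \<omega> \<partial>M)"
    using nn_integral_Markov_inequality [of "\<lambda>\<omega>. \<Prod>i\<in>I. ennreal (exp (h i (Z i \<omega>)))" "space M" M
        "ennreal (exp (- u\<^sup>2 / (4 * v)))"] by simp
  also have "\<dots> = ennreal (exp (- u\<^sup>2 / (4 * v))) *
      (\<integral>\<^sup>+\<omega>. (\<Prod>i\<in>I. ennreal (exp (h i (Z i \<omega>)))) \<partial>M)"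
    by (intro arg_cong2 [where f = times] nn_integral_cong) auto
  also have "\<dots> \<le> ennreal (exp (- u\<^sup>2 / (4 * v))) * 1"
    unfolding prod by (intro mult_left_mono prod_le_1) (auto intro: one)
  finally show ?thesis by (simp add: emeasure_eq_measure)
qed

end

section \<open>Strong convexity of powers of the distance\<close>

lemma abs_powr_diff_le:
  fixes a b c \<alpha> :: real
  assumes "1 \<le> \<alpha>" "0 \<le> a" "a \<le> c" "0 \<le> b" "b \<le> c"
  shows "\<bar>a powr \<alpha> - b powr \<alpha>\<bar> \<le> \<alpha> * \<bar>a - b\<bar> * c powr (\<alpha> - 1)"
proof -
  have main: "y powr \<alpha> - x powr \<alpha> \<le> \<alpha> * (y - x) * c powr (\<alpha> - 1)"
    if "0 \<le> x" "x < y" "y \<le> c" for x y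
  proof (cases "x = 0")
    case True
    have "y powr \<alpha> = y * y powr (\<alpha> - 1)" using that by (simp add: powr_mult_base)
    also have "\<dots> \<le> (\<alpha> * y) * c powr (\<alpha> - 1)"
      using that assms by (intro mult_mono powr_mono2) auto
    finally show ?thesis using True by simp
  next
    case False
    have "\<exists>\<xi>. x < \<xi> \<and> \<xi> < y \<and> y powr \<alpha> - x powr \<alpha> = (y - x) * (\<alpha> * \<xi> powr (\<alpha> - 1))"
      using that False by (intro MVT2) (auto intro!: derivative_eq_intros)
    then obtain \<xi> where \<xi>: "x < \<xi>" "\<xi> < y"
      "y powr \<alpha> - x powr \<alpha> = (y - x) * (\<alpha> * \<xi> powr (\<alpha> - 1))" by blast
    have "(y - x) * (\<alpha> * \<xi> powr (\<alpha> - 1)) \<le> (y - x) * (\<alpha> * c powr (\<alpha> - 1))"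
      using that \<xi> assms by (intro mult_left_mono powr_mono2) auto
    then show ?thesis using \<xi> by (simp add: algebra_simps)
  qed
  have mono: "x powr \<alpha> \<le> y powr \<alpha>" if "0 \<le> x" "x \<le> y" for x y
    using that assms by (intro powr_mono2) auto
  consider "a < b" | "a = b" | "b < a" by linarith
  then show ?thesis
    using main [of a b] main [of b a] mono [of a b] mono [of b a] assms by cases auto
qed

text \<open>
  The second derivative of \<open>x\<^sup>\<alpha>\<close> is at least \<open>\<kappa> = \<alpha> (\<alpha> - 1) c\<^sup>\<alpha>\<^sup>-\<^sup>2\<close> on \<open>(0, c]\<close>, because \<open>\<alpha> \<le> 2\<close>. Hence
  \<open>x\<^sup>\<alpha> - \<kappa> x\<^sup>2/2\<close> is convex there, and the square contributes \<open>\<kappa> (a - b)\<^sup>2/8\<close> at the midpoint.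
\<close>

lemma powr_midpoint_strongly_convex_pos:
  fixes a b c \<alpha> :: real
  assumes "1 \<le> \<alpha>" "\<alpha> \<le> 2" "0 < a" "a \<le> c" "0 < b" "b \<le> c"
  shows "\<alpha> * (\<alpha> - 1) / 8 * c powr (\<alpha> - 2) * (a - b)\<^sup>2
    \<le> a powr \<alpha> / 2 + b powr \<alpha> / 2 - ((a + b) / 2) powr \<alpha>"
proof -
  define \<kappa> where "\<kappa> = \<alpha> * (\<alpha> - 1) * c powr (\<alpha> - 2)"
  define g where "g x = x powr \<alpha> - \<kappa> / 2 * x\<^sup>2" for x :: real
  define g' where "g' x = \<alpha> * x powr (\<alpha> - 1) - \<kappa> * x" for x :: real
  have "g' x \<le> g' y" if "0 < x" "x \<le> y" "y \<le> c" for x y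
  proof (rule DERIV_nonneg_imp_nondecreasing [OF \<open>x \<le> y\<close>])
    fix t assume t: "x \<le> t" "t \<le> y"
    have "(g' has_real_derivative \<alpha> * ((\<alpha> - 1) * t powr (\<alpha> - 2)) - \<kappa>) (at t)"
      unfolding g'_def using that t by (auto intro!: derivative_eq_intros)
    moreover have "\<alpha> * ((\<alpha> - 1) * c powr (\<alpha> - 2)) \<le> \<alpha> * ((\<alpha> - 1) * t powr (\<alpha> - 2))"
      using that t assms by (intro mult_left_mono powr_mono2') auto
    ultimately show "\<exists>d. (g' has_real_derivative d) (at t) \<and> 0 \<le> d"
      by (intro exI conjI) (auto simp: \<kappa>_def algebra_simps)
  qed
  moreover have "(g has_real_derivative g' x) (at x)" if "0 < x" for x
    unfolding g_def g'_def using that by (auto intro!: derivative_eq_intros)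
  ultimately have "convex_on {0<..c} g"
    by (intro convex_on_realI [where f' = g']) auto
  then have "g ((1 - 1/2) *\<^sub>R a + (1/2) *\<^sub>R b) \<le> (1 - 1/2) * g a + 1/2 * g b"
    using assms by (intro convex_onD) auto
  moreover have "(1 - 1/2) *\<^sub>R a + (1/2) *\<^sub>R b = (a + b) / 2" by simp
  ultimately have "g ((a + b) / 2) \<le> g a / 2 + g b / 2" by (simp add: add_divide_distrib)
  moreover have "\<kappa> / 2 * (a\<^sup>2 / 2 + b\<^sup>2 / 2 - ((a + b) / 2)\<^sup>2) = \<kappa> / 8 * (a - b)\<^sup>2"
    by (simp add: power2_eq_square field_simps)
  moreover have "a powr \<alpha> / 2 + b powr \<alpha> / 2 - ((a + b) / 2) powr \<alpha>
      = (g a / 2 + g b / 2 - g ((a + b) / 2)) + \<kappa> / 2 * (a\<^sup>2 / 2 + b\<^sup>2 / 2 - ((a + b) / 2)\<^sup>2)"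
    by (simp add: g_def right_diff_distrib distrib_left diff_divide_distrib)
  ultimately have "\<kappa> / 8 * (a - b)\<^sup>2 \<le> a powr \<alpha> / 2 + b powr \<alpha> / 2 - ((a + b) / 2) powr \<alpha>"
    by linarith
  then show ?thesis by (simp add: \<kappa>_def algebra_simps)
qed

text \<open>
  The endpoint \<open>0\<close>, where the second derivative is unbounded for \<open>\<alpha> < 2\<close>, is reached by shifting all arguments by
  \<open>e > 0\<close> and letting \<open>e\<close> tend to \<open>0\<close>.
\<close>

lemma powr_midpoint_strongly_convex:
  fixes a b c \<alpha> :: real
  assumes "1 < \<alpha>" "\<alpha> \<le> 2" "0 \<le> a" "a \<le> c" "0 \<le> b" "b \<le> c" "0 < c"
  shows "\<alpha> * (\<alpha> - 1) / 8 * c powr (\<alpha> - 2) * (a - b)\<^sup>2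
    \<le> a powr \<alpha> / 2 + b powr \<alpha> / 2 - ((a + b) / 2) powr \<alpha>"
proof (rule tendsto_le)
  let ?F = "at_right (0::real)"
  show "?F \<noteq> bot" by simp
  show "((\<lambda>e. (a + e) powr \<alpha> / 2 + (b + e) powr \<alpha> / 2 - ((a + e + (b + e)) / 2) powr \<alpha>) \<longlongrightarrow>
      a powr \<alpha> / 2 + b powr \<alpha> / 2 - ((a + b) / 2) powr \<alpha>) ?F"
    using assms by (intro tendsto_intros tendsto_powr2 tendsto_eq_intros)
      (auto simp: eventually_at_filter)
  show "((\<lambda>e. \<alpha> * (\<alpha> - 1) / 8 * (c + e) powr (\<alpha> - 2) * (a - b)\<^sup>2) \<longlongrightarrow>
      \<alpha> * (\<alpha> - 1) / 8 * c powr (\<alpha> - 2) * (a - b)\<^sup>2) ?F"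
    using assms by (auto intro!: tendsto_eq_intros)
  have "eventually (\<lambda>e. e > 0) ?F" by (simp add: eventually_at_right_less)
  then show "eventually (\<lambda>e. \<alpha> * (\<alpha> - 1) / 8 * (c + e) powr (\<alpha> - 2) * (a - b)\<^sup>2
      \<le> (a + e) powr \<alpha> / 2 + (b + e) powr \<alpha> / 2 - ((a + e + (b + e)) / 2) powr \<alpha>) ?F"
  proof eventually_elim
    case (elim e)
    then show ?case
      using powr_midpoint_strongly_convex_pos [of \<alpha> "a + e" "c + e" "b + e"] assms by simp
  qed
qed

lemma powr_tangent_le:
  fixes x y \<gamma> :: real
  assumes "0 < \<gamma>" "\<gamma> \<le> 1" "0 \<le> y" "y \<le> x" "0 < x"
  shows "y powr \<gamma> \<le> x powr \<gamma> - \<gamma> * x powr (\<gamma> - 1) * (x - y)"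
proof -
  consider "y = x" | "y = 0" | "0 < y" "y < x" using assms by linarith
  then show ?thesis
  proof cases
    case 2
    have "x powr \<gamma> = x powr (\<gamma> - 1) * x" using assms by (simp add: powr_mult_base mult.commute)
    then have "x powr \<gamma> - \<gamma> * x powr (\<gamma> - 1) * (x - y) = (1 - \<gamma>) * x powr \<gamma>"
      using 2 by (simp add: algebra_simps)
    also have "\<dots> \<ge> 0" using assms by simp
    finally show ?thesis using 2 by simp
  next
    case 3
    have "\<exists>\<xi>. y < \<xi> \<and> \<xi> < x \<and> x powr \<gamma> - y powr \<gamma> = (x - y) * (\<gamma> * \<xi> powr (\<gamma> - 1))"
      using 3 by (intro MVT2) (auto intro!: derivative_eq_intros)
    then obtain \<xi> where \<xi>: "y < \<xi>" "\<xi> < x"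
      "x powr \<gamma> - y powr \<gamma> = (x - y) * (\<gamma> * \<xi> powr (\<gamma> - 1))" by blast
    have "(x - y) * (\<gamma> * x powr (\<gamma> - 1)) \<le> (x - y) * (\<gamma> * \<xi> powr (\<gamma> - 1))"
      using \<xi> 3 assms by (intro mult_left_mono powr_mono2') auto
    then show ?thesis using \<xi> by (simp add: algebra_simps)
  qed simp
qed

text \<open>
  The inequality of Bruhat and Tits, which characterises the midpoint of a geodesic in a Hadamard space.
\<close>

definition is_midpoint :: "'a::metric_space \<Rightarrow> 'a \<Rightarrow> 'a \<Rightarrow> bool" where
  "is_midpoint x y p \<longleftrightarrow>
     (\<forall>q. (dist q p)\<^sup>2 \<le> (dist x q)\<^sup>2 / 2 + (dist y q)\<^sup>2 / 2 - (dist x y)\<^sup>2 / 4)"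

lemma midpoint_exists: "\<exists>p. is_midpoint x y p" for x y :: "'a::hadamard_space"
  using hadamard_midpoint [of x y] by (simp add: is_midpoint_def)

lemma dist_midpoint:
  fixes x y p :: "'a::metric_space"
  assumes "is_midpoint x y p"
  shows "dist x p = dist x y / 2"
proof -
  have "(dist x p)\<^sup>2 \<le> (dist x y / 2)\<^sup>2" "(dist y p)\<^sup>2 \<le> (dist x y / 2)\<^sup>2"
    using assms [unfolded is_midpoint_def, rule_format, of x]
      assms [unfolded is_midpoint_def, rule_format, of y]
    by (simp_all add: dist_commute power_divide)
  then have "dist x p \<le> dist x y / 2" "dist y p \<le> dist x y / 2"
    by (simp_all add: power2_le_iff_abs_le)
  then show ?thesis using dist_triangle2 [of x y p] by linarith
qed

text \<open>
  Let \<open>a = d(q,x)\<close>, \<open>b = d(q,y)\<close>, \<open>d = d(x,y)\<close> and \<open>s = (a + b)/2\<close>. The midpoint inequality reads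
  \<open>d(q,p)\<^sup>2 \<le> s\<^sup>2 - e\<close> with \<open>e = (d\<^sup>2 - (a - b)\<^sup>2)/4 \<ge> 0\<close>. Passing to the power \<open>\<alpha>/2\<close> gains a multiple of
  \<open>e\<close> by concavity, and replacing \<open>s\<^sup>\<alpha>\<close> by the mean of \<open>a\<^sup>\<alpha>\<close> and \<open>b\<^sup>\<alpha>\<close> gains a multiple of \<open>(a - b)\<^sup>2\<close> by
  strong convexity. Each gain alone may vanish; together they give the full \<open>d\<^sup>2\<close>, since \<open>\<alpha> - 1 \<le> 1\<close>.
\<close>

lemma powr_dist_midpoint_le:
  fixes x y p q :: "'a::metric_space"
  assumes p: "is_midpoint x y p" and \<alpha>: "1 < \<alpha>" "\<alpha> \<le> 2"
  shows "dist q p powr \<alpha> + \<alpha> * (\<alpha> - 1) / 8 * (dist x y)\<^sup>2 * (dist q x + dist x y) powr (\<alpha> - 2)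
    \<le> (dist q x powr \<alpha> + dist q y powr \<alpha>) / 2"
proof (cases "x = y")
  case True
  then show ?thesis using dist_midpoint [OF p] by simp
next
  case False
  define a b d c s where "a = dist q x" and "b = dist q y" and "d = dist x y"
    and "c = dist q x + dist x y" and "s = (a + b) / 2"
  have d: "0 < d" using False by (simp add: d_def)
  have tri: "d \<le> a + b" "\<bar>a - b\<bar> \<le> d" "b \<le> c" "a \<le> c" "0 < c" "0 \<le> a" "0 \<le> b"
    using dist_triangle3 [of x y q] dist_triangle [of q x y] dist_triangle2 [of q y x] d
    by (auto simp: a_def b_def c_def d_def dist_commute abs_le_iff add_pos_nonneg add_nonneg_pos)
  have s: "0 < s" "s \<le> c" using tri d by (auto simp: s_def)
  define e where "e = (d\<^sup>2 - (a - b)\<^sup>2) / 4"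
  have e: "0 \<le> e" using tri d by (simp add: e_def abs_le_square_iff [symmetric])
  have "(dist q p)\<^sup>2 \<le> a\<^sup>2 / 2 + b\<^sup>2 / 2 - d\<^sup>2 / 4"
    using p [unfolded is_midpoint_def, rule_format, of q]
    by (simp add: a_def b_def d_def dist_commute)
  also have "\<dots> = s\<^sup>2 - e"
    by (simp add: s_def e_def power2_eq_square field_simps)
  finally have qp: "(dist q p)\<^sup>2 \<le> s\<^sup>2 - e" .
  then have es: "e \<le> s\<^sup>2" using zero_le_power2 [of "dist q p"] by linarith
  have sq: "t powr (2 * \<gamma>) = (t\<^sup>2) powr \<gamma>" if "0 \<le> t" for t \<gamma> :: real
    using that by (cases "t = 0") (auto simp: powr_powr [symmetric])
  have "dist q p powr \<alpha> = ((dist q p)\<^sup>2) powr (\<alpha> / 2)"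
    using sq [of "dist q p" "\<alpha> / 2"] by simp
  also have "\<dots> \<le> (s\<^sup>2 - e) powr (\<alpha> / 2)"
    using qp \<alpha> by (intro powr_mono2) auto
  also have "\<dots> \<le> (s\<^sup>2) powr (\<alpha> / 2) - \<alpha> / 2 * (s\<^sup>2) powr (\<alpha> / 2 - 1) * (s\<^sup>2 - (s\<^sup>2 - e))"
    using \<alpha> s e es by (intro powr_tangent_le) auto
  also have "\<dots> = s powr \<alpha> - \<alpha> / 2 * s powr (\<alpha> - 2) * e"
    using sq [of s "\<alpha> / 2"] sq [of s "\<alpha> / 2 - 1"] s by (simp add: algebra_simps)
  finally have 1: "dist q p powr \<alpha> \<le> s powr \<alpha> - \<alpha> / 2 * s powr (\<alpha> - 2) * e" .
  have 2: "\<alpha> * (\<alpha> - 1) / 8 * c powr (\<alpha> - 2) * (a - b)\<^sup>2 \<le> a powr \<alpha> / 2 + b powr \<alpha> / 2 - s powr \<alpha>"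
    unfolding s_def using tri \<alpha> by (intro powr_midpoint_strongly_convex) auto
  have "\<alpha> * (\<alpha> - 1) / 2 * c powr (\<alpha> - 2) * e \<le> \<alpha> / 2 * s powr (\<alpha> - 2) * e"
    using s e \<alpha> by (intro mult_right_mono mult_mono powr_mono2') auto
  moreover have "\<alpha> * (\<alpha> - 1) / 2 * c powr (\<alpha> - 2) * e + \<alpha> * (\<alpha> - 1) / 8 * c powr (\<alpha> - 2) * (a - b)\<^sup>2
      = \<alpha> * (\<alpha> - 1) / 8 * d\<^sup>2 * c powr (\<alpha> - 2)"
    by (simp add: e_def field_simps)
  ultimately show ?thesis
    using 1 2 unfolding a_def [symmetric] b_def [symmetric] d_def [symmetric] c_def [symmetric]
    by (simp add: c_def a_def d_def field_simps)
qed

text \<open>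
  Replacing \<open>q\<close> by the midpoint of \<open>m\<close> and \<open>q\<close> halves the distance to \<open>m\<close> and, by convexity, keeps the
  value of \<open>\<phi>\<close> at most \<open>\<phi> m\<close>. Halving cannot jump over the shell \<open>(\<rho>/2, \<rho>]\<close>.
\<close>

lemma midpoint_convex_localize:
  fixes \<phi> :: "'a::hadamard_space \<Rightarrow> real"
  assumes convex: "\<And>q p. is_midpoint m q p \<Longrightarrow> \<phi> p \<le> (\<phi> m + \<phi> q) / 2"
    and q: "\<phi> q \<le> \<phi> m" "\<rho> < dist m q" and \<rho>: "0 < \<rho>"
  shows "\<exists>p. \<rho> / 2 < dist m p \<and> dist m p \<le> \<rho> \<and> \<phi> p \<le> \<phi> m"
proof -
  have "\<exists>p. \<rho> / 2 < dist m p \<and> dist m p \<le> \<rho> \<and> \<phi> p \<le> \<phi> m"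
    if "\<phi> q \<le> \<phi> m" "\<rho> / 2 < dist m q" "dist m q \<le> 2 ^ k * \<rho>" for k q
    using that
  proof (induction k arbitrary: q)
    case (Suc k)
    show ?case
    proof (cases "dist m q \<le> \<rho>")
      case False
      obtain p where p: "is_midpoint m q p" using midpoint_exists by blast
      show ?thesis
        using Suc.IH [of p] Suc.prems convex [OF p] dist_midpoint [OF p] False by auto
    qed (use Suc.prems in auto)
  qed auto
  moreover obtain k where "dist m q / \<rho> < 2 ^ k"
    using real_arch_pow [of 2 "dist m q / \<rho>"] by auto
  then have "dist m q \<le> 2 ^ k * \<rho>" using \<rho> by (simp add: field_simps)
  ultimately show ?thesis using q \<rho> by auto
qed

section \<open>The variance inequality for power means\<close>

lemma powr_add_le:
  fixes a b \<gamma> :: real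
  assumes "0 \<le> a" "0 \<le> b" "0 \<le> \<gamma>"
  shows "(a + b) powr \<gamma> \<le> 2 powr \<gamma> * (a powr \<gamma> + b powr \<gamma>)"
proof -
  have "(a + b) powr \<gamma> \<le> (2 * max a b) powr \<gamma>" using assms by (intro powr_mono2) auto
  also have "\<dots> = 2 powr \<gamma> * max a b powr \<gamma>" using assms by (simp add: powr_mult)
  also have "max a b powr \<gamma> \<le> a powr \<gamma> + b powr \<gamma>" by (simp add: max_def)
  finally show ?thesis by simp
qed

text \<open>
  With one argument fixed this is continuity of the distance, also when the space fails to be second
  countable and the distance may not be measurable on the product.
\<close>

lemma borel_measurable_dist_left [measurable (raw)]:
  fixes f :: "'w \<Rightarrow> 'a::metric_space"
  assumes "f \<in> borel_measurable M"
  shows "(\<lambda>x. dist (f x) a) \<in> borel_measurable M"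
  using assms by (rule measurable_compose) (intro borel_measurable_continuous_onI continuous_intros)

context prob_space
begin

lemma integrable_powr_dist_diff:
  fixes Y :: "'a \<Rightarrow> 'b::metric_space"
  assumes [measurable]: "Y \<in> borel_measurable M"
    and \<alpha>: "1 \<le> \<alpha>" and int: "integrable M (\<lambda>\<omega>. dist (Y \<omega>) z powr (\<alpha> - 1))"
  shows "integrable M (\<lambda>\<omega>. dist (Y \<omega>) p powr \<alpha> - dist (Y \<omega>) q powr \<alpha>)"
proof (rule Bochner_Integration.integrable_bound)
  define r where "r = dist p z + dist q z"
  show "integrable M (\<lambda>\<omega>. \<alpha> * dist p q * (2 powr (\<alpha> - 1) * (dist (Y \<omega>) z powr (\<alpha> - 1) + r powr (\<alpha> - 1))))"
    using int by auto
  have "\<bar>dist y p powr \<alpha> - dist y q powr \<alpha>\<bar>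
      \<le> \<alpha> * dist p q * (2 powr (\<alpha> - 1) * (dist y z powr (\<alpha> - 1) + r powr (\<alpha> - 1)))" for y
  proof -
    have "dist y p \<le> dist y z + r" "dist y q \<le> dist y z + r" "0 \<le> r"
      using dist_triangle2 [of y p z] dist_triangle2 [of y q z] zero_le_dist [of p z] zero_le_dist [of q z]
      unfolding r_def by linarith+
    then have "\<bar>dist y p powr \<alpha> - dist y q powr \<alpha>\<bar>
        \<le> \<alpha> * \<bar>dist y p - dist y q\<bar> * (dist y z + r) powr (\<alpha> - 1)"
      using \<alpha> by (intro abs_powr_diff_le) auto
    also have "\<dots> \<le> \<alpha> * dist p q * (2 powr (\<alpha> - 1) * (dist y z powr (\<alpha> - 1) + r powr (\<alpha> - 1)))"
      using \<alpha> \<open>0 \<le> r\<close> abs_dist_diff_le [of p y q]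
      by (intro mult_mono powr_add_le mult_nonneg_nonneg) (auto simp: dist_commute)
    finally show ?thesis .
  qed
  then show "AE \<omega> in M. norm (dist (Y \<omega>) p powr \<alpha> - dist (Y \<omega>) q powr \<alpha>)
      \<le> norm (\<alpha> * dist p q * (2 powr (\<alpha> - 1) * (dist (Y \<omega>) z powr (\<alpha> - 1) + r powr (\<alpha> - 1))))"
    by (intro always_eventually allI) (use abs_ge_self order_trans in \<open>simp only: real_norm_def, blast\<close>)
qed measurable

text \<open>
  Let \<open>p\<close> be the midpoint of \<open>m\<close> and \<open>q\<close>. Integrating \<open>powr_dist_midpoint_le\<close> gives
  \<open>E f\<^sub>p \<le> E f\<^sub>q / 2 - gain\<close>, while \<open>E f\<^sub>p \<ge> 0\<close> because \<open>m\<close> is a minimiser; so \<open>E f\<^sub>q\<close> is at least twice the gain.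
\<close>

lemma frechet_mean_variance_inequality:
  fixes Y :: "'a \<Rightarrow> 'b::hadamard_space"
  assumes [measurable]: "Y \<in> borel_measurable M"
    and \<alpha>: "1 < \<alpha>" "\<alpha> \<le> 2" and int: "integrable M (\<lambda>\<omega>. dist (Y \<omega>) z powr (\<alpha> - 1))"
    and mean: "is_frechet_mean \<alpha> M Y z m"
  shows "\<alpha> * (\<alpha> - 1) / 4 * (dist m q)\<^sup>2 * expectation (\<lambda>\<omega>. (dist (Y \<omega>) m + dist m q) powr (\<alpha> - 2))
    \<le> expectation (\<lambda>\<omega>. dist (Y \<omega>) q powr \<alpha> - dist (Y \<omega>) m powr \<alpha>)"
proof (cases "q = m")
  case False
  define f where "f q \<omega> = dist (Y \<omega>) q powr \<alpha> - dist (Y \<omega>) m powr \<alpha>" for q \<omega>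
  define w where "w \<omega> = (dist (Y \<omega>) m + dist m q) powr (\<alpha> - 2)" for \<omega>
  have f_int: "integrable M (f q)" for q
    unfolding f_def using integrable_powr_dist_diff [OF _ _ int] \<alpha> by simp
  have w_int: "integrable M w"
  proof (rule integrable_const_bound [where B = "dist m q powr (\<alpha> - 2)"])
    show "AE \<omega> in M. norm (w \<omega>) \<le> dist m q powr (\<alpha> - 2)"
      using False \<alpha> by (auto simp: w_def intro!: powr_mono2')
  qed (unfold w_def, measurable)
  obtain p where p: "is_midpoint m q p" using midpoint_exists by blast
  have "0 \<le> expectation (f p)"
  proof -
    let ?g = "\<lambda>p \<omega>. dist (Y \<omega>) p powr \<alpha> - dist (Y \<omega>) z powr \<alpha>"
    have g_int: "integrable M (?g p)" for p
      using integrable_powr_dist_diff [OF _ _ int] \<alpha> by simp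
    have "expectation (?g m) \<le> expectation (?g p)"
      using mean by (auto simp: is_frechet_mean_def is_arg_min_linorder)
    also have "\<dots> = expectation (\<lambda>\<omega>. f p \<omega> + ?g m \<omega>)" by (simp add: f_def)
    also have "\<dots> = expectation (f p) + expectation (?g m)"
      by (intro Bochner_Integration.integral_add f_int g_int)
    finally show ?thesis by simp
  qed
  also have "expectation (f p) \<le> expectation (\<lambda>\<omega>. f q \<omega> / 2 - \<alpha> * (\<alpha> - 1) / 8 * (dist m q)\<^sup>2 * w \<omega>)"
  proof (intro integral_mono)
    fix \<omega>
    show "f p \<omega> \<le> f q \<omega> / 2 - \<alpha> * (\<alpha> - 1) / 8 * (dist m q)\<^sup>2 * w \<omega>"
      using powr_dist_midpoint_le [OF p \<alpha>, of "Y \<omega>"] by (simp add: f_def w_def field_simps)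
  qed (intro f_int w_int Bochner_Integration.integrable_diff integrable_divide integrable_mult_right)+
  also have "\<dots> = expectation (f q) / 2 - \<alpha> * (\<alpha> - 1) / 8 * (dist m q)\<^sup>2 * expectation w"
    using f_int w_int by simp
  finally show ?thesis by (simp add: f_def [abs_def] w_def [abs_def])
qed simp

text \<open>
  For \<open>\<beta> = 2\<close> the expectation in the variance inequality stays above its value at distance \<open>1\<close>. For
  \<open>\<beta> < 2\<close> it is bounded below by the contribution of the event \<open>d(Y,m) \<le> d\<close>, which is
  \<open>(2 d)\<^sup>\<alpha>\<^sup>-\<^sup>2\<close> times a probability of order at least \<open>d\<^sup>\<beta>\<^sup>-\<^sup>\<alpha>\<close>; multiplied by \<open>d\<^sup>2\<close> this is of order \<open>d\<^sup>\<beta>\<close>.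
\<close>

lemma frechet_mean_growth:
  fixes Y :: "'a \<Rightarrow> 'b::hadamard_space"
  assumes Y [measurable]: "Y \<in> borel_measurable M"
    and \<alpha>: "1 < \<alpha>" "\<alpha> \<le> 2" and int: "integrable M (\<lambda>\<omega>. dist (Y \<omega>) z powr (\<alpha> - 1))"
    and mean: "is_frechet_mean \<alpha> M Y z m"
    and \<beta>: "\<beta> = 2 \<or> (\<alpha> \<le> \<beta> \<and> \<beta> < 2 \<and>
       Liminf (at_right 0)
         (\<lambda>t. ereal (t powr (\<alpha> - \<beta>) * prob {\<omega>\<in>space M. dist (Y \<omega>) m \<le> t})) > 0)"
  shows "\<exists>c>0. \<exists>r>0. \<forall>q. dist m q < r \<longrightarrow>
    c * dist m q powr \<beta> \<le> expectation (\<lambda>\<omega>. dist (Y \<omega>) q powr \<alpha> - dist (Y \<omega>) m powr \<alpha>)"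
proof -
  define w where "w d \<omega> = (dist (Y \<omega>) m + d) powr (\<alpha> - 2)" for d \<omega>
  have w_int: "integrable M (w d)" if "0 < d" for d
  proof (rule integrable_const_bound [where B = "d powr (\<alpha> - 2)"])
    show "AE \<omega> in M. norm (w d \<omega>) \<le> d powr (\<alpha> - 2)"
      using that \<alpha> by (auto simp: w_def intro!: powr_mono2')
  qed (unfold w_def, measurable)
  have "\<exists>c>0. \<exists>r>0. \<forall>d. 0 < d \<and> d < r \<longrightarrow> c * d powr \<beta> \<le> d\<^sup>2 * expectation (w d)"
  proof (cases "\<beta> = 2")
    case True
    have "0 < expectation (w 1)"
    proof -
      have "0 \<le> expectation (w 1)" by (intro Bochner_Integration.integral_nonneg) (simp add: w_def)
      moreover have "expectation (w 1) \<noteq> 0"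
      proof
        assume "expectation (w 1) = 0"
        then have "AE \<omega> in M. w 1 \<omega> = 0"
          using w_int [of 1] by (subst (asm) integral_nonneg_eq_0_iff_AE) (auto simp: w_def)
        moreover have "w 1 \<omega> \<noteq> 0" for \<omega>
          using add_nonneg_pos [of "dist (Y \<omega>) m" 1] by (simp add: w_def)
        ultimately show False by simp
      qed
      ultimately show ?thesis by simp
    qed
    moreover have "expectation (w 1) * d powr \<beta> \<le> d\<^sup>2 * expectation (w d)" if d: "0 < d" "d < 1" for d
    proof -
      have "expectation (w 1) \<le> expectation (w d)"
      proof (intro integral_mono w_int)
        show "w 1 \<omega> \<le> w d \<omega>" for \<omega>
          using d \<alpha> add_nonneg_pos [of "dist (Y \<omega>) m" d]
          unfolding w_def by (intro powr_mono2') auto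
      qed (use d in auto)
      then show ?thesis using True d by (simp add: powr_numeral mult.commute)
    qed
    ultimately show ?thesis by (intro exI [of _ "expectation (w 1)"] conjI exI [of _ 1]) auto
  next
    case False
    define P where "P t = prob {\<omega>\<in>space M. dist (Y \<omega>) m \<le> t}" for t
    have "0 < Liminf (at_right 0) (\<lambda>t. ereal (t powr (\<alpha> - \<beta>) * P t))"
      using False \<beta> by (auto simp: P_def)
    then obtain c where c: "0 < ereal c" "ereal c < Liminf (at_right 0) (\<lambda>t. ereal (t powr (\<alpha> - \<beta>) * P t))"
      using ereal_dense2 by blast
    from c(2) have "eventually (\<lambda>t. ereal c < ereal (t powr (\<alpha> - \<beta>) * P t)) (at_right 0)"
      by (rule less_LiminfD)
    then obtain r where r: "0 < r" "\<And>t. 0 < t \<Longrightarrow> t < r \<Longrightarrow> c < t powr (\<alpha> - \<beta>) * P t"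
      by (auto simp: eventually_at_right_field)
    have "2 powr (\<alpha> - 2) * c * d powr \<beta> \<le> d\<^sup>2 * expectation (w d)" if d: "0 < d" "d < r" for d
    proof -
      have "(2 * d) powr (\<alpha> - 2) * P d
          = expectation (\<lambda>\<omega>. (2 * d) powr (\<alpha> - 2) * indicator {\<omega>\<in>space M. dist (Y \<omega>) m \<le> d} \<omega>)"
        by (simp add: P_def)
      also have "\<dots> \<le> expectation (w d)"
      proof (rule integral_mono)
        fix \<omega>
        show "(2 * d) powr (\<alpha> - 2) * indicator {\<omega>\<in>space M. dist (Y \<omega>) m \<le> d} \<omega> \<le> w d \<omega>"
          using d \<alpha> add_nonneg_pos [of "dist (Y \<omega>) m" d]
          by (auto simp: w_def indicator_def intro!: powr_mono2')
      qed (use w_int d in \<open>auto intro!: integrable_real_indicator simp: less_top [symmetric]\<close>)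
      finally have "d\<^sup>2 * ((2 * d) powr (\<alpha> - 2) * P d) \<le> d\<^sup>2 * expectation (w d)"
        by (intro mult_left_mono) auto
      moreover have "d\<^sup>2 * ((2 * d) powr (\<alpha> - 2) * P d) = 2 powr (\<alpha> - 2) * d powr \<beta> * (d powr (\<alpha> - \<beta>) * P d)"
      proof -
        have "d\<^sup>2 * d powr (\<alpha> - 2) = d powr \<beta> * d powr (\<alpha> - \<beta>)"
        proof -
          have "d\<^sup>2 = d powr 2" using d by simp
          then show ?thesis by (simp only: powr_add [symmetric]) simp
        qed
        then show ?thesis using d by (simp add: powr_mult algebra_simps)
      qed
      moreover have "2 powr (\<alpha> - 2) * d powr \<beta> * c \<le> 2 powr (\<alpha> - 2) * d powr \<beta> * (d powr (\<alpha> - \<beta>) * P d)"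
        using r(2) [OF d] by (intro mult_left_mono) auto
      ultimately have "2 powr (\<alpha> - 2) * d powr \<beta> * c \<le> d\<^sup>2 * expectation (w d)" by linarith
      then show ?thesis by (simp only: mult_ac)
    qed
    then show ?thesis using c r by (intro exI [of _ "2 powr (\<alpha> - 2) * c"] conjI exI [of _ r]) auto
  qed
  then obtain c r where c: "0 < c" "0 < r"
    "\<And>d. 0 < d \<Longrightarrow> d < r \<Longrightarrow> c * d powr \<beta> \<le> d\<^sup>2 * expectation (w d)" by blast
  have "\<alpha> * (\<alpha> - 1) / 4 * c * dist m q powr \<beta>
      \<le> expectation (\<lambda>\<omega>. dist (Y \<omega>) q powr \<alpha> - dist (Y \<omega>) m powr \<alpha>)" if "dist m q < r" for q
  proof (cases "q = m")
    case False
    have "\<alpha> * (\<alpha> - 1) / 4 * (c * dist m q powr \<beta>)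
        \<le> \<alpha> * (\<alpha> - 1) / 4 * ((dist m q)\<^sup>2 * expectation (w (dist m q)))"
      using False that \<alpha> by (intro mult_left_mono c) auto
    also have "\<dots> \<le> expectation (\<lambda>\<omega>. dist (Y \<omega>) q powr \<alpha> - dist (Y \<omega>) m powr \<alpha>)"
      using frechet_mean_variance_inequality [OF Y \<alpha> int mean, of q] by (simp add: w_def [abs_def])
    finally show ?thesis by simp
  qed simp
  then show ?thesis using c \<alpha> by (intro exI [of _ "\<alpha> * (\<alpha> - 1) / 4 * c"] conjI exI [of _ r]) auto
qed

end

section \<open>Finite nets from the entropy condition\<close>

lemma covering_number_attained:
  fixes B :: "'a::metric_space set"
  assumes "covering_number B r = enat k"
  obtains q :: "nat \<Rightarrow> 'a" where "B \<subseteq> (\<Union>l\<in>{1..k}. cball (q l) r)"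
proof -
  let ?K = "{enat k | k. \<exists>q :: nat \<Rightarrow> 'a. B \<subseteq> (\<Union>l\<in>{1..k}. cball (q l) r)}"
  have "enat k = Inf ?K" using assms by (simp add: covering_number_def)
  then have "?K \<noteq> {}" unfolding Inf_enat_def by force
  then have "Inf ?K \<in> ?K"
    unfolding Inf_enat_def using LeastI_ex [of "\<lambda>x. x \<in> ?K"] by (simp only: if_False) blast
  with \<open>enat k = Inf ?K\<close> have "enat k \<in> ?K" by simp
  then show ?thesis using that by auto
qed

text \<open>
  Covering balls may be centred outside \<open>B\<close>, where increments of the process are not controlled. Moving
  each useful centre into \<open>B\<close> at most doubles the radius.
\<close>

lemma finite_net_of_covering:
  fixes q :: "nat \<Rightarrow> 'a::metric_space"
  assumes "B \<subseteq> (\<Union>l\<in>{1..k}. cball (q l) r)"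
  shows "\<exists>N. finite N \<and> N \<subseteq> B \<and> card N \<le> k \<and> (\<forall>x\<in>B. \<exists>y\<in>N. dist x y \<le> 2 * r)"
proof -
  define L where "L = {l \<in> {1..k}. B \<inter> cball (q l) r \<noteq> {}}"
  define c where "c l = (SOME x. x \<in> B \<inter> cball (q l) r)" for l
  have c: "c l \<in> B \<inter> cball (q l) r" if "l \<in> L" for l
  proof -
    have "\<exists>x. x \<in> B \<inter> cball (q l) r" using that by (auto simp: L_def)
    then show ?thesis unfolding c_def by (rule someI_ex)
  qed
  have L: "L \<subseteq> {1..k}" by (auto simp: L_def)
  have "finite L" by (rule finite_subset [OF L]) simp
  moreover have "card L \<le> k" using card_mono [OF _ L] by simp
  ultimately have "finite (c ` L)" "card (c ` L) \<le> k"
    using card_image_le [of L c] by auto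
  moreover have "c ` L \<subseteq> B" using c by auto
  moreover have "\<exists>y\<in>c ` L. dist x y \<le> 2 * r" if x: "x \<in> B" for x
  proof -
    obtain l where l: "l \<in> {1..k}" "x \<in> cball (q l) r" using assms x by auto
    then have "l \<in> L" using x by (auto simp: L_def)
    then have "dist x (c l) \<le> 2 * r"
      using c [of l] l dist_triangle3 [of x "c l" "q l"] by simp
    with \<open>l \<in> L\<close> show ?thesis by auto
  qed
  ultimately show ?thesis by (intro exI [of _ "c ` L"]) simp
qed

lemma entropy_condition_finite_nets:
  assumes "entropy_condition TYPE('a::metric_space)"
  shows "\<exists>s C R0. 0 < s \<and> s < 2 \<and> 0 \<le> C \<and> 0 < R0 \<and>
    (\<forall>(q::'a) R r. 0 < r \<and> r < R \<and> R < R0 \<longrightarrow>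
       (\<exists>N. finite N \<and> N \<subseteq> cball q R \<and> card N \<le> exp (C * (R / r) powr s) \<and>
         (\<forall>x\<in>cball q R. \<exists>y\<in>N. dist x y \<le> 2 * r)))"
proof -
  define E where "E s R = (SUP q :: 'a. SUP r\<in>{0<..<R}.
      ereal (r powr s * R powr (- s)) * ln_enat (covering_number (cball q R) r))" for s R :: real
  obtain s where s: "0 < s" "s < 2" "Limsup (at_right 0) (E s) < \<infinity>"
    using assms by (auto simp: entropy_condition_def E_def [abs_def])
  then obtain K :: nat where "Limsup (at_right 0) (E s) < ereal (real K)"
    by (auto simp: less_PInf_Ex_of_nat)
  then have "eventually (\<lambda>R. E s R < ereal (real K)) (at_right 0)"
    by (rule Limsup_lessD)
  then obtain R0 where R0: "0 < R0" "\<And>R. 0 < R \<Longrightarrow> R < R0 \<Longrightarrow> E s R < ereal (real K)"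
    by (auto simp: eventually_at_right_field)
  have nets: "\<exists>N. finite N \<and> N \<subseteq> cball q R \<and> card N \<le> exp (real K * (R / r) powr s) \<and>
         (\<forall>x\<in>cball q R. \<exists>y\<in>N. dist x y \<le> 2 * r)"
    if r: "0 < r" "r < R" "R < R0" for q :: 'a and R r
  proof -
    let ?w = "r powr s * R powr (- s)"
    have w: "0 < ?w" using r by simp
    have "ereal ?w * ln_enat (covering_number (cball q R) r) \<le> E s R"
      unfolding E_def using r by (intro SUP_upper2 [of q] SUP_upper) auto
    also have "\<dots> < ereal (real K)" using R0 r by auto
    finally have lt: "ereal ?w * ln_enat (covering_number (cball q R) r) < ereal (real K)" .
    have "covering_number (cball q R) r \<noteq> \<infinity>"
    proof
      assume "covering_number (cball q R) r = \<infinity>"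
      then have "ereal ?w * ln_enat (covering_number (cball q R) r) = \<infinity>"
        using r by (simp add: ln_enat_def)
      with lt show False by simp
    qed
    then obtain k where k: "covering_number (cball q R) r = enat k" by auto
    obtain c :: "nat \<Rightarrow> 'a" where c: "cball q R \<subseteq> (\<Union>l\<in>{1..k}. cball (c l) r)"
      using covering_number_attained [OF k] .
    have "q \<in> cball q R" using r by simp
    then have "k \<noteq> 0" using c by (cases k) auto
    have "?w * ln (real k) < real K" using lt k by (simp add: ln_enat_def)
    then have "ln (real k) < real K / ?w" using w by (simp add: pos_less_divide_eq mult.commute)
    also have "real K / ?w = real K * (R / r) powr s"
      using r by (simp add: powr_divide powr_minus divide_simps)
    finally have "exp (ln (real k)) \<le> exp (real K * (R / r) powr s)" by simp
    then have "real k \<le> exp (real K * (R / r) powr s)" using \<open>k \<noteq> 0\<close> by simp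
    moreover obtain N where N: "finite N" "N \<subseteq> cball q R" "card N \<le> k"
        "\<forall>x\<in>cball q R. \<exists>y\<in>N. dist x y \<le> 2 * r"
      using finite_net_of_covering [OF c] by blast
    ultimately have "real (card N) \<le> exp (real K * (R / r) powr s)" by linarith
    with N show ?thesis by blast
  qed
  show ?thesis
  proof (intro exI conjI)
    show "0 < s" "s < 2" "0 < R0" by (fact s R0)+
    show "0 \<le> real K" by simp
  qed (use nets in blast)
qed

section \<open>Chaining with a random envelope\<close>

context prob_space
begin

text \<open>
  The variance proxy of \<open>self_normalized_tail_bound\<close> is dominated by \<open>\<delta>\<^sup>2\<close> times a quantity depending on
  \<open>G\<close> only. The conditioning event is therefore the same for all increments \<open>h\<close>, which is what permits a
  union bound over many of them.
\<close>

lemma centred_process_increment_tail: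
  fixes X :: "'i \<Rightarrow> 'a \<Rightarrow> 'b" and h :: "'b \<Rightarrow> real"
  assumes I: "finite I" and indep: "indep_vars (\<lambda>_. S) X I"
    and h [measurable]: "h \<in> borel_measurable S" and G [measurable]: "G \<in> borel_measurable S"
    and hG: "\<And>y. y \<in> space S \<Longrightarrow> \<bar>h y\<bar> \<le> \<delta> * G y"
    and centred: "\<And>i. i \<in> I \<Longrightarrow> expectation (\<lambda>\<omega>. h (X i \<omega>)) = 0"
    and G_int: "\<And>i. i \<in> I \<Longrightarrow> integrable M (\<lambda>\<omega>. (G (X i \<omega>))\<^sup>2)"
    and G_le: "\<And>i. i \<in> I \<Longrightarrow> expectation (\<lambda>\<omega>. (G (X i \<omega>))\<^sup>2) \<le> A"
    and pos: "0 < A" "0 < \<delta>" "0 \<le> u" "0 < card I"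
  shows "prob {\<omega> \<in> space M. (\<Sum>i\<in>I. (G (X i \<omega>))\<^sup>2) \<le> A * card I \<and> u \<le> (\<Sum>i\<in>I. h (X i \<omega>))}
    \<le> exp (- u\<^sup>2 / (2 * \<delta>\<^sup>2 * A * card I))" (is "prob ?A \<le> _")
proof -
  have X [measurable]: "X i \<in> measurable M S" if "i \<in> I" for i
    using indep that by (auto simp: indep_vars_def)
  have sq_le: "(h y)\<^sup>2 \<le> \<delta>\<^sup>2 * (G y)\<^sup>2" if "y \<in> space S" for y
    using power_mono [OF hG [OF that] abs_ge_zero, of 2] by (simp add: power_mult_distrib)
  have X_space: "X i \<omega> \<in> space S" if "i \<in> I" "\<omega> \<in> space M" for i \<omega>
    using measurable_space [OF X] that by auto
  have h_int: "integrable M (\<lambda>\<omega>. (h (X i \<omega>))\<^sup>2)" if i: "i \<in> I" for i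
  proof (rule Bochner_Integration.integrable_bound)
    show "integrable M (\<lambda>\<omega>. \<delta>\<^sup>2 * (G (X i \<omega>))\<^sup>2)" using G_int [OF i] by simp
    show "(\<lambda>\<omega>. (h (X i \<omega>))\<^sup>2) \<in> borel_measurable M" using i by measurable
    show "AE \<omega> in M. norm ((h (X i \<omega>))\<^sup>2) \<le> norm (\<delta>\<^sup>2 * (G (X i \<omega>))\<^sup>2)"
      using sq_le X_space [OF i] by (intro AE_I2) auto
  qed
  have h_le: "expectation (\<lambda>\<omega>. (h (X i \<omega>))\<^sup>2) \<le> \<delta>\<^sup>2 * A" if i: "i \<in> I" for i
  proof -
    have "expectation (\<lambda>\<omega>. (h (X i \<omega>))\<^sup>2) \<le> expectation (\<lambda>\<omega>. \<delta>\<^sup>2 * (G (X i \<omega>))\<^sup>2)"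
      using h_int [OF i] G_int [OF i] sq_le X_space [OF i] by (intro integral_mono) auto
    also have "\<dots> \<le> \<delta>\<^sup>2 * A" using G_le [OF i] by (simp add: mult_left_mono)
    finally show ?thesis .
  qed
  let ?v = "\<delta>\<^sup>2 * A * card I / 2"
  let ?B = "{\<omega> \<in> space M. u \<le> (\<Sum>i\<in>I. h (X i \<omega>)) \<and>
      (\<Sum>i\<in>I. (h (X i \<omega>))\<^sup>2 / 6 + expectation (\<lambda>\<omega>. (h (X i \<omega>))\<^sup>2) / 3) \<le> ?v}"
  have "prob ?A \<le> prob ?B"
  proof (rule finite_measure_mono)
    show "?A \<subseteq> ?B"
    proof
      fix \<omega> assume w: "\<omega> \<in> ?A"
      have "(\<Sum>i\<in>I. (h (X i \<omega>))\<^sup>2 / 6 + expectation (\<lambda>\<omega>. (h (X i \<omega>))\<^sup>2) / 3)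
          \<le> (\<Sum>i\<in>I. \<delta>\<^sup>2 * (G (X i \<omega>))\<^sup>2 / 6 + \<delta>\<^sup>2 * A / 3)"
        using w h_le X_space by (intro sum_mono add_mono divide_right_mono sq_le) auto
      also have "\<dots> = \<delta>\<^sup>2 / 6 * (\<Sum>i\<in>I. (G (X i \<omega>))\<^sup>2) + card I * (\<delta>\<^sup>2 * A / 3)"
        by (simp add: sum.distrib sum_distrib_left)
      also have "\<dots> \<le> \<delta>\<^sup>2 / 6 * (A * card I) + card I * (\<delta>\<^sup>2 * A / 3)"
        using w by (intro add_mono mult_left_mono) auto
      also have "\<dots> = ?v" by (simp add: field_simps)
      finally show "\<omega> \<in> ?B" using w by simp
    qed
    show "?B \<in> events" using X by measurable
  qed
  also have "\<dots> \<le> exp (- u\<^sup>2 / (4 * ?v))"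
  proof (rule self_normalized_tail_bound [OF I])
    show "indep_vars (\<lambda>_. borel) (\<lambda>i \<omega>. h (X i \<omega>)) I"
      by (rule indep_vars_compose2 [OF indep]) measurable
    show "0 < ?v" using pos by simp
  qed (use h_int centred pos in auto)
  also have "4 * ?v = 2 * \<delta>\<^sup>2 * A * card I" by simp
  finally show ?thesis .
qed

text \<open>
  Each point of the net \<open>N k\<close> is linked to a point of \<open>N (k - 1)\<close> at distance at most \<open>4 \<rho> / 2\<^sup>k\<close>, and
  the link may contribute \<open>u k = \<tau> \<rho> \<surd>n (\<surd>b / 2)\<^sup>k\<close>. The factor \<open>(\<surd>b)\<^sup>k\<close> makes the tail of one link
  \<open>exp (- (C + T) b\<^sup>k)\<close>, which beats the number \<open>exp (C b\<^sup>k)\<close> of links, and \<open>b < 4\<close> makes the sum of the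
  \<open>u k\<close> a convergent geometric series. After \<open>n\<close> levels the remaining distance \<open>2 \<rho> / 2\<^sup>n \<le> 2 \<rho> / \<surd>n\<close> is
  so small that the crude Lipschitz bound is enough. In this way only finitely many measurable events
  enter, and the supremum over the possibly uncountable set \<open>B\<close> is never formed.
\<close>

lemma chaining_tail_bound:
  fixes X :: "nat \<Rightarrow> 'a \<Rightarrow> 'b" and h :: "'p::metric_space \<Rightarrow> 'b \<Rightarrow> real" and N :: "nat \<Rightarrow> 'p set"
  assumes n: "0 < n" and indep: "indep_vars (\<lambda>_. S) X {1..n}"
    and h [measurable]: "\<And>p. p \<in> B \<Longrightarrow> h p \<in> borel_measurable S"
    and G [measurable]: "G \<in> borel_measurable S"
    and hG: "\<And>p q y. p \<in> B \<Longrightarrow> q \<in> B \<Longrightarrow> y \<in> space S \<Longrightarrow> \<bar>h p y - h q y\<bar> \<le> dist p q * G y"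
    and G_nonneg: "\<And>y. 0 \<le> G y"
    and h_int: "\<And>p i. p \<in> B \<Longrightarrow> i \<in> {1..n} \<Longrightarrow> integrable M (\<lambda>\<omega>. h p (X i \<omega>))"
    and centred: "\<And>p i. p \<in> B \<Longrightarrow> i \<in> {1..n} \<Longrightarrow> expectation (\<lambda>\<omega>. h p (X i \<omega>)) = 0"
    and base: "\<And>y. h m y = 0"
    and G_int: "\<And>i. i \<in> {1..n} \<Longrightarrow> integrable M (\<lambda>\<omega>. (G (X i \<omega>))\<^sup>2)"
    and G_le: "\<And>i. i \<in> {1..n} \<Longrightarrow> expectation (\<lambda>\<omega>. (G (X i \<omega>))\<^sup>2) \<le> A"
    and net: "\<And>k. finite (N k)" "\<And>k. N k \<subseteq> B" "N 0 = {m}"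
      "\<And>k x. x \<in> B \<Longrightarrow> \<exists>y\<in>N k. dist x y \<le> 2 * \<rho> / 2 ^ k"
    and card_net: "\<And>k. 0 < k \<Longrightarrow> card (N k) \<le> exp (C * b ^ k)"
    and pos: "0 < A" "0 < \<rho>" "0 \<le> C" "0 \<le> T" "0 < b" "b < 4"
  shows "\<exists>E\<in>events.
    prob E \<le> prob {\<omega> \<in> space M. A * n < (\<Sum>i=1..n. (G (X i \<omega>))\<^sup>2)} + (\<Sum>k=1..n. exp (- T * b ^ k)) \<and>
    (\<forall>\<omega>\<in>space M - E. \<forall>q\<in>B. (\<Sum>i=1..n. h q (X i \<omega>))
      \<le> \<rho> * sqrt n * (sqrt (32 * A * (C + T)) / (1 - sqrt b / 2) + 2 * sqrt A))"
proof -
  define \<tau> \<gamma> where "\<tau> = sqrt (32 * A * (C + T))" and "\<gamma> = sqrt b / 2"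
  have \<tau>: "0 \<le> \<tau>" "\<tau>\<^sup>2 = 32 * A * (C + T)" using pos by (auto simp: \<tau>_def)
  have \<gamma>: "0 < \<gamma>" "\<gamma> < 1" "\<gamma>\<^sup>2 = b / 4"
    using pos real_sqrt_less_mono [of b 4] by (auto simp: \<gamma>_def power_divide)
  have X [measurable]: "X i \<in> measurable M S" if "i \<in> {1..n}" for i
    using indep that by (auto simp: indep_vars_def)
  define u where "u k = \<tau> * \<rho> * sqrt n * \<gamma> ^ k" for k
  define \<delta> where "\<delta> k = 4 * \<rho> / 2 ^ k" for k :: nat
  define \<pi> where "\<pi> k p = (SOME y. y \<in> N (k - 1) \<and> dist p y \<le> \<delta> k)" for k p
  have \<pi>: "\<pi> k p \<in> N (k - 1) \<and> dist p (\<pi> k p) \<le> \<delta> k" if "p \<in> N k" "0 < k" for p k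
  proof -
    have "\<exists>y\<in>N (k - 1). dist p y \<le> \<delta> k"
      using net(4) [of p "k - 1"] net(2) [of k] that by (cases k) (auto simp: \<delta>_def)
    then have "\<exists>y. y \<in> N (k - 1) \<and> dist p y \<le> \<delta> k" by blast
    then show ?thesis unfolding \<pi>_def by (rule someI_ex)
  qed
  note \<pi> = \<pi> [THEN conjunct1] \<pi> [THEN conjunct2]
  define W where "W = {\<omega> \<in> space M. A * n < (\<Sum>i=1..n. (G (X i \<omega>))\<^sup>2)}"
  define L where "L k p = {\<omega> \<in> space M. (\<Sum>i=1..n. (G (X i \<omega>))\<^sup>2) \<le> A * n \<and>
      u k \<le> (\<Sum>i=1..n. h p (X i \<omega>) - h (\<pi> k p) (X i \<omega>))}" for k p
  \<comment> \<open>the exceptional event: the envelope is atypically large, or some link exceeds its share\<close>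
  define E where "E = W \<union> (\<Union>k\<in>{1..n}. \<Union>p\<in>N k. L k p)"
  have in_B: "p \<in> B" "\<pi> k p \<in> B" if "p \<in> N k" "0 < k" for p k
    using net(2) \<pi>(1) that by blast+
  have G_meas: "(\<lambda>\<omega>. \<Sum>i=1..n. (G (X i \<omega>))\<^sup>2) \<in> borel_measurable M"
    by (intro borel_measurable_sum borel_measurable_power measurable_compose [OF X G])
  have W_meas: "W \<in> events" unfolding W_def using G_meas by measurable
  have L_meas: "L k p \<in> events" if "p \<in> N k" "0 < k" for k p
  proof -
    have "(\<lambda>\<omega>. \<Sum>i=1..n. h p (X i \<omega>) - h (\<pi> k p) (X i \<omega>)) \<in> borel_measurable M"
      using in_B [OF that]
      by (intro borel_measurable_sum borel_measurable_diff measurable_compose [OF X h])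
    then show ?thesis unfolding L_def using G_meas by measurable
  qed
  have L_prob: "prob (L k p) \<le> exp (- (C + T) * b ^ k)" if p: "p \<in> N k" "0 < k" for k p
  proof -
    let ?h = "\<lambda>y. h p y - h (\<pi> k p) y"
    have "prob (L k p) \<le> exp (- (u k)\<^sup>2 / (2 * (\<delta> k)\<^sup>2 * A * card {1..n}))"
      unfolding L_def
    proof (rule order_trans [OF _ centred_process_increment_tail [where h = ?h and G = G, OF _ indep]])
      show "\<bar>?h y\<bar> \<le> \<delta> k * G y" if "y \<in> space S" for y
        using hG [OF in_B [OF p] that] mult_right_mono [OF \<pi>(2) [OF p] G_nonneg [of y]] by linarith
      show "?h \<in> borel_measurable S" using in_B [OF p] by measurable
      show "expectation (\<lambda>\<omega>. ?h (X i \<omega>)) = 0" if "i \<in> {1..n}" for i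
        using h_int centred in_B [OF p] that by simp
    qed (use G_int G_le pos n \<tau> \<gamma> in \<open>auto simp: \<delta>_def u_def\<close>)
    also have "- (u k)\<^sup>2 / (2 * (\<delta> k)\<^sup>2 * A * card {1..n}) = - (C + T) * b ^ k"
    proof -
      have "(\<gamma> ^ k)\<^sup>2 = (b / 4) ^ k" using \<gamma> by (metis power_even_eq power_mult)
      moreover have "((2::real) ^ k)\<^sup>2 = 4 ^ k" by (simp add: power2_eq_square flip: power_mult_distrib)
      ultimately show ?thesis
        using n pos \<tau> unfolding u_def \<delta>_def by (simp add: power_mult_distrib power_divide)
          (simp add: field_simps)
    qed
    finally show ?thesis .
  qed
  have "prob E \<le> prob W + prob (\<Union>k\<in>{1..n}. \<Union>p\<in>N k. L k p)"
    unfolding E_def using L_meas net(1)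
    by (intro measure_Un_le W_meas sets.finite_UN) auto
  also have "prob (\<Union>k\<in>{1..n}. \<Union>p\<in>N k. L k p) \<le> (\<Sum>k=1..n. prob (\<Union>p\<in>N k. L k p))"
    using L_meas net(1) by (intro measure_UNION_le) auto
  also have "\<dots> \<le> (\<Sum>k=1..n. exp (- T * b ^ k))"
  proof (intro sum_mono)
    fix k assume "k \<in> {1..n}"
    then have k: "0 < k" by simp
    have "prob (\<Union>p\<in>N k. L k p) \<le> (\<Sum>p\<in>N k. prob (L k p))"
      using L_meas [OF _ k] net(1) by (intro measure_UNION_le) auto
    also have "\<dots> \<le> card (N k) * exp (- (C + T) * b ^ k)"
      by (rule sum_bounded_above) (rule L_prob [OF _ k])
    also have "\<dots> \<le> exp (C * b ^ k) * exp (- (C + T) * b ^ k)"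
      using card_net [OF k] by (intro mult_right_mono) auto
    also have "\<dots> = exp (- T * b ^ k)" by (simp add: exp_add [symmetric] algebra_simps)
    finally show "prob (\<Union>p\<in>N k. L k p) \<le> exp (- T * b ^ k)" .
  qed
  finally have E_prob: "prob E \<le> prob W + (\<Sum>k=1..n. exp (- T * b ^ k))" by simp
  have E_meas: "E \<in> events" unfolding E_def
    using L_meas W_meas net(1) by (intro sets.Un sets.finite_UN) auto
  have sup: "(\<Sum>i=1..n. h q (X i \<omega>)) \<le> \<rho> * sqrt n * (\<tau> / (1 - \<gamma>) + 2 * sqrt A)"
    if \<omega>: "\<omega> \<in> space M - E" and q: "q \<in> B" for \<omega> q
  proof -
    define s where "s p = (\<Sum>i=1..n. h p (X i \<omega>))" for p
    have G2: "(\<Sum>i=1..n. (G (X i \<omega>))\<^sup>2) \<le> A * n" using \<omega> by (auto simp: E_def W_def)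
    have link: "s p - s (\<pi> k p) \<le> u k" if "p \<in> N k" "k \<in> {1..n}" for p k
      using \<omega> that G2 by (fastforce simp: E_def L_def s_def sum_subtractf)
    have chain: "s p \<le> (\<Sum>j=1..k. u j)" if "p \<in> N k" "k \<le> n" for p k
      using that
    proof (induction k arbitrary: p)
      case 0
      then show ?case using net(3) base by (simp add: s_def)
    next
      case (Suc k)
      then have "s (\<pi> (Suc k) p) \<le> (\<Sum>j=1..k. u j)" using \<pi>(1) [of p "Suc k"] by auto
      with link [of p "Suc k"] Suc.prems show ?case by simp
    qed
    obtain p where p: "p \<in> N n" "dist q p \<le> 2 * \<rho> / 2 ^ n" using net(4) [OF q] by blast
    have G1: "(\<Sum>i=1..n. G (X i \<omega>)) \<le> n * sqrt A"
    proof -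
      have "(\<Sum>i=1..n. G (X i \<omega>) * 1)\<^sup>2 \<le> (\<Sum>i=1..n. (G (X i \<omega>))\<^sup>2) * (\<Sum>i=1..n. 1\<^sup>2)"
        by (rule Cauchy_Schwarz_ineq_sum)
      also have "\<dots> \<le> (A * n) * n" using G2 by (simp add: mult_right_mono)
      also have "\<dots> = (n * sqrt A)\<^sup>2" using pos by (simp add: power_mult_distrib power2_eq_square)
      finally show ?thesis using pos by (simp add: power2_le_iff_abs_le)
    qed
    \<comment> \<open>the last step, from the finest net to \<open>q\<close>, is bounded pathwise\<close>
    have "s q - s p \<le> (\<Sum>i=1..n. dist q p * G (X i \<omega>))"
      unfolding s_def sum_subtractf [symmetric]
    proof (rule sum_mono)
      fix i assume "i \<in> {1..n}"
      then have "X i \<omega> \<in> space S" using measurable_space [OF X] \<omega> by auto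
      then show "h q (X i \<omega>) - h p (X i \<omega>) \<le> dist q p * G (X i \<omega>)"
        using hG [of q p "X i \<omega>"] q p net(2) by (force simp: abs_le_iff)
    qed
    also have "\<dots> = dist q p * (\<Sum>i=1..n. G (X i \<omega>))" by (simp add: sum_distrib_left)
    also have "\<dots> \<le> (2 * \<rho> / 2 ^ n) * (n * sqrt A)"
      using p G1 G_nonneg pos by (intro mult_mono sum_nonneg) auto
    also have "\<dots> = 2 * \<rho> * sqrt A * sqrt n * (sqrt n / 2 ^ n)"
      by simp
    also have "\<dots> \<le> 2 * \<rho> * sqrt A * sqrt n * 1"
    proof (intro mult_left_mono)
      have "sqrt n \<le> real n" using n real_sqrt_le_iff [of n "(real n)\<^sup>2"] by (simp add: power2_eq_square)
      also have "\<dots> \<le> 2 ^ n" using of_nat_less_two_power [of n] by (simp add: less_imp_le)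
      finally show "sqrt n / 2 ^ n \<le> 1" by simp
    qed (use pos in auto)
    finally have "s q \<le> s p + 2 * \<rho> * sqrt A * sqrt n" by simp
    also have "s p \<le> (\<Sum>j=1..n. u j)" using chain p by auto
    also have "(\<Sum>j=1..n. u j) = \<tau> * \<rho> * sqrt n * (\<Sum>j=1..n. \<gamma> ^ j)"
      by (simp add: u_def sum_distrib_left)
    also have "\<dots> \<le> \<tau> * \<rho> * sqrt n * (1 / (1 - \<gamma>))"
    proof (intro mult_left_mono)
      have "(\<Sum>j=1..n. \<gamma> ^ j) \<le> (\<Sum>j<Suc n. \<gamma> ^ j)"
        using \<gamma> by (intro sum_mono2) auto
      also have "\<dots> = (1 - \<gamma> ^ Suc n) / (1 - \<gamma>)"
        using \<gamma> by (subst sum_gp_strict) auto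
      also have "\<dots> \<le> 1 / (1 - \<gamma>)" using \<gamma> by (intro divide_right_mono) auto
      finally show "(\<Sum>j=1..n. \<gamma> ^ j) \<le> 1 / (1 - \<gamma>)" .
    qed (use pos \<tau> in auto)
    finally show ?thesis by (simp add: s_def algebra_simps)
  qed
  show ?thesis
    using E_meas E_prob sup unfolding W_def \<tau>_def \<gamma>_def by blast
qed

end

section \<open>Uniform deviations over small balls\<close>

text \<open>
  By Bernoulli's inequality \<open>b\<^sup>k \<ge> k (b - 1)\<close>, so the sum is dominated by a geometric series whose ratio
  \<open>x\<close> is chosen with \<open>x / (1 - x) = \<epsilon>\<close>.
\<close>

lemma sum_exp_neg_power_small:
  fixes b \<epsilon> :: real
  assumes "1 < b" "0 < \<epsilon>"
  shows "\<exists>T\<ge>0. \<forall>n. (\<Sum>k=1..n. exp (- T * b ^ k)) \<le> \<epsilon>"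
proof -
  define x where "x = \<epsilon> / (1 + \<epsilon>)"
  have x: "0 < x" "x < 1" "x / (1 - x) = \<epsilon>"
    using assms by (auto simp: x_def field_simps)
  define T where "T = - ln x / (b - 1)"
  have T: "0 \<le> T" "T * (b - 1) = - ln x"
    using x assms by (auto simp: T_def intro!: divide_nonpos_pos)
  have "(\<Sum>k=1..n. exp (- T * b ^ k)) \<le> \<epsilon>" for n
  proof -
    have "(\<Sum>k=1..n. exp (- T * b ^ k)) \<le> (\<Sum>k=1..n. x ^ k)"
    proof (rule sum_mono)
      fix k
      have "real k * (b - 1) \<le> b ^ k"
        using Bernoulli_inequality [of "b - 1" k] assms by simp
      then have "T * (real k * (b - 1)) \<le> T * b ^ k" using T by (intro mult_left_mono)
      moreover have "T * (real k * (b - 1)) = - (real k * ln x)"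
        by (simp only: mult.left_commute [of T] T(2))
      ultimately have "exp (- T * b ^ k) \<le> exp (real k * ln x)" by simp
      also have "\<dots> = x ^ k" using x by (simp add: exp_of_nat_mult)
      finally show "exp (- T * b ^ k) \<le> x ^ k" .
    qed
    also have "\<dots> = x * (\<Sum>k<n. x ^ k)"
      by (simp add: sum_distrib_left sum.atLeast1_atMost_eq)
    also have "\<dots> = x * ((1 - x ^ n) / (1 - x))" using x by (subst sum_gp_strict) auto
    also have "\<dots> \<le> x * (1 / (1 - x))" using x by (intro mult_left_mono divide_right_mono) auto
    finally show ?thesis using x by simp
  qed
  with T show ?thesis by blast
qed

text \<open>
  The net at level \<open>0\<close> consists of the centre alone, where the process to be chained vanishes.
\<close>

lemma multiscale_nets:
  assumes nets: "\<And>r. 0 < r \<Longrightarrow> r < \<rho> \<Longrightarrow>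
       \<exists>N. finite N \<and> N \<subseteq> cball q \<rho> \<and> card N \<le> exp (C * (\<rho> / r) powr s) \<and>
         (\<forall>x\<in>cball q \<rho>. \<exists>y\<in>N. dist x y \<le> 2 * r)"
    and \<rho>: "0 < \<rho>"
  obtains N :: "nat \<Rightarrow> 'a::metric_space set" where
    "\<And>k. finite (N k)" "\<And>k. N k \<subseteq> cball q \<rho>" "N 0 = {q}"
    "\<And>k x. x \<in> cball q \<rho> \<Longrightarrow> \<exists>y\<in>N k. dist x y \<le> 2 * \<rho> / 2 ^ k"
    "\<And>k. 0 < k \<Longrightarrow> card (N k) \<le> exp (C * (2 powr s) ^ k)"
proof -
  define P where "P k N \<longleftrightarrow> finite N \<and> N \<subseteq> cball q \<rho> \<and> (k = 0 \<longrightarrow> N = {q}) \<and>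
      (0 < k \<longrightarrow> card N \<le> exp (C * (2 powr s) ^ k)) \<and>
      (\<forall>x\<in>cball q \<rho>. \<exists>y\<in>N. dist x y \<le> 2 * \<rho> / 2 ^ k)" for k :: nat and N
  have ex: "\<exists>N. P k N" for k
  proof (cases "k = 0")
    case True
    then show ?thesis using \<rho> by (intro exI [of _ "{q}"]) (auto simp: P_def dist_commute)
  next
    case False
    then have "1 < (2::real) ^ k" by simp
    then have "\<rho> / 2 ^ k < \<rho>" using \<rho> by (simp add: divide_less_eq)
    then obtain N where N: "finite N" "N \<subseteq> cball q \<rho>" "card N \<le> exp (C * (\<rho> / (\<rho> / 2 ^ k)) powr s)"
        "\<forall>x\<in>cball q \<rho>. \<exists>y\<in>N. dist x y \<le> 2 * (\<rho> / 2 ^ k)"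
      using nets [of "\<rho> / 2 ^ k"] \<rho> by auto
    have "(\<rho> / (\<rho> / 2 ^ k)) powr s = (2 powr s) ^ k"
      using \<rho> by (simp add: powr_realpow [symmetric] powr_powr mult.commute powr_power)
    with N False show ?thesis by (intro exI [of _ N]) (simp add: P_def)
  qed
  define N where "N k = (SOME N. P k N)" for k
  have N: "P k (N k)" for k unfolding N_def by (rule someI_ex [OF ex])
  show ?thesis
  proof (rule that [of N])
    fix k x
    show "finite (N k)" "N k \<subseteq> cball q \<rho>" using N [of k] by (simp_all add: P_def)
    show "N 0 = {q}" using N [of 0] by (simp add: P_def)
    show "\<exists>y\<in>N k. dist x y \<le> 2 * \<rho> / 2 ^ k" if "x \<in> cball q \<rho>"
      using N [of k] that unfolding P_def by blast
    show "card (N k) \<le> exp (C * (2 powr s) ^ k)" if "0 < k"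
      using N [of k] that unfolding P_def by blast
  qed
qed

context prob_space
begin

text \<open>
  Chaining for \<open>h\<^sub>q = E f\<^sub>q(Y) - f\<^sub>q\<close>, whose increments have the square integrable Lipschitz constant
  \<open>G = F + E F(Y)\<close>. Since \<open>m\<close> has distance at most \<open>\<rho>\<close> to all points considered, the bound is linear in
  \<open>\<rho>\<close>, with \<open>K\<close> depending on the tolerated probability \<open>\<epsilon>\<close> but not on \<open>\<rho>\<close> and \<open>n\<close>.
\<close>

lemma local_empirical_process_bound:
  fixes Y :: "'a \<Rightarrow> 'b::topological_space" and Ys :: "nat \<Rightarrow> 'a \<Rightarrow> 'b"
    and f :: "'p::metric_space \<Rightarrow> 'b \<Rightarrow> real"
  assumes entropy: "entropy_condition TYPE('p)"
    and Y [measurable]: "Y \<in> borel_measurable M"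
    and indep: "indep_vars (\<lambda>_. borel) Ys {1..}"
    and copies: "\<And>j. j \<ge> 1 \<Longrightarrow> distr M borel (Ys j) = distr M borel Y"
    and f: "\<And>p. f p \<in> borel_measurable borel"
    and F [measurable]: "F \<in> borel_measurable borel" and F_nonneg: "\<And>y. 0 \<le> F y"
    and F_int: "integrable M (\<lambda>\<omega>. (F (Y \<omega>))\<^sup>2)"
    and lipschitz: "\<And>p q y. p \<in> cball m 1 \<Longrightarrow> q \<in> cball m 1 \<Longrightarrow> \<bar>f p y - f q y\<bar> \<le> dist p q * F y"
    and base: "\<And>y. f m y = 0"
    and \<epsilon>: "0 < \<epsilon>"
  shows "\<exists>K. \<exists>R>0. \<forall>\<rho> n. 0 < \<rho> \<longrightarrow> \<rho> < R \<longrightarrow> 0 < n \<longrightarrow> (\<exists>E\<in>events. prob E \<le> \<epsilon> \<and>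
    (\<forall>\<omega>\<in>space M - E. \<forall>q\<in>cball m \<rho>.
       (\<Sum>i=1..n. expectation (\<lambda>\<omega>. f q (Y \<omega>)) - f q (Ys i \<omega>)) \<le> K * \<rho> * sqrt n))"
proof -
  have Ys: "Ys i \<in> borel_measurable M" if "i \<in> {1..}" for i
    using indep that by (auto simp: indep_vars_def)
  have transfer: "expectation (\<lambda>\<omega>. g (Ys i \<omega>)) = expectation (\<lambda>\<omega>. g (Y \<omega>))"
    "integrable M (\<lambda>\<omega>. g (Ys i \<omega>)) \<longleftrightarrow> integrable M (\<lambda>\<omega>. g (Y \<omega>))"
    if "i \<in> {1..}" "g \<in> borel_measurable borel" for g :: "'b \<Rightarrow> real" and i
    using integral_distr [OF Ys [OF that(1)] that(2)] integral_distr [OF Y that(2)]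
      integrable_distr_eq [OF Ys [OF that(1)] that(2)] integrable_distr_eq [OF Y that(2)]
      copies [of i] that(1) by auto
  have F_int1: "integrable M (\<lambda>\<omega>. F (Y \<omega>))"
    by (rule square_integrable_imp_integrable [OF _ F_int]) measurable
  have f_int: "integrable M (\<lambda>\<omega>. f p (Y \<omega>))" if "p \<in> cball m 1" for p
  proof (rule Bochner_Integration.integrable_bound)
    show "integrable M (\<lambda>\<omega>. dist p m * F (Y \<omega>))" using F_int1 by simp
    show "(\<lambda>\<omega>. f p (Y \<omega>)) \<in> borel_measurable M" by (rule measurable_compose [OF Y f])
    show "AE \<omega> in M. norm (f p (Y \<omega>)) \<le> norm (dist p m * F (Y \<omega>))"
      using lipschitz [OF that, of m] base F_nonneg by (intro AE_I2) simp
  qed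
  define G where "G y = F y + expectation (\<lambda>\<omega>. F (Y \<omega>))" for y
  have G [measurable]: "G \<in> borel_measurable borel" unfolding G_def by measurable
  have EF: "0 \<le> expectation (\<lambda>\<omega>. F (Y \<omega>))" by (intro Bochner_Integration.integral_nonneg F_nonneg)
  have G_nonneg: "0 \<le> G y" for y using F_nonneg [of y] EF by (simp add: G_def)
  have G_int: "integrable M (\<lambda>\<omega>. (G (Y \<omega>))\<^sup>2)"
    unfolding G_def power2_sum using F_int F_int1 by auto
  have G2 [measurable]: "(\<lambda>y. (G y)\<^sup>2) \<in> borel_measurable borel" by measurable
  define h where "h p y = expectation (\<lambda>\<omega>. f p (Y \<omega>)) - f p y" for p y
  have h [measurable]: "h p \<in> borel_measurable borel" for p
    unfolding h_def using f [of p] by measurable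
  have h_lip: "\<bar>h p y - h q y\<bar> \<le> dist p q * G y" if pq: "p \<in> cball m 1" "q \<in> cball m 1" for p q y
  proof -
    have "\<bar>expectation (\<lambda>\<omega>. f p (Y \<omega>)) - expectation (\<lambda>\<omega>. f q (Y \<omega>))\<bar>
        = \<bar>expectation (\<lambda>\<omega>. f p (Y \<omega>) - f q (Y \<omega>))\<bar>"
      using f_int pq by simp
    also have "\<dots> \<le> expectation (\<lambda>\<omega>. \<bar>f p (Y \<omega>) - f q (Y \<omega>)\<bar>)" by (rule integral_abs_bound)
    also have "\<dots> \<le> expectation (\<lambda>\<omega>. dist p q * F (Y \<omega>))"
      using f_int pq F_int1 lipschitz by (intro integral_mono) auto
    also have "\<dots> = dist p q * expectation (\<lambda>\<omega>. F (Y \<omega>))" by simp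
    finally show ?thesis using lipschitz [OF pq, of y] by (simp add: h_def G_def distrib_left)
  qed
  have h_centred: "integrable M (\<lambda>\<omega>. h p (Ys i \<omega>))" "expectation (\<lambda>\<omega>. h p (Ys i \<omega>)) = 0"
    if "p \<in> cball m 1" "i \<in> {1..}" for p i
    using transfer [OF that(2) h] f_int [OF that(1)] by (auto simp: h_def prob_space)
  define V where "V = expectation (\<lambda>\<omega>. (G (Y \<omega>))\<^sup>2)"
  \<comment> \<open>by Markov's inequality \<open>\<Sum>\<^sub>i G(Ys\<^sub>i)\<^sup>2\<close> exceeds \<open>A n\<close> with probability at most \<open>V / A \<le> \<epsilon> / 2\<close>\<close>
  define A where "A = V * (1 + 2 / \<epsilon>) + 1"
  have V: "0 \<le> V" unfolding V_def by simp
  have A: "0 < A" "V \<le> A" "V * (2 / \<epsilon>) \<le> A"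
  proof -
    have "A = V + V * (2 / \<epsilon>) + 1" by (simp add: A_def distrib_left)
    moreover have "0 \<le> V * (2 / \<epsilon>)" using V \<epsilon> by simp
    ultimately show "0 < A" "V \<le> A" "V * (2 / \<epsilon>) \<le> A" using V by linarith+
  qed
  obtain s C R0 :: real where s: "0 < s" "s < 2" and C: "0 \<le> C" and R0: "0 < R0"
    and all_nets: "\<forall>(q::'p) R r. 0 < r \<and> r < R \<and> R < R0 \<longrightarrow>
       (\<exists>N. finite N \<and> N \<subseteq> cball q R \<and> card N \<le> exp (C * (R / r) powr s) \<and>
         (\<forall>x\<in>cball q R. \<exists>y\<in>N. dist x y \<le> 2 * r))"
    using entropy_condition_finite_nets [OF entropy] by (elim exE conjE) (rule that)
  note nets = all_nets [rule_format, OF conjI, OF _ conjI]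
  define b where "b = 2 powr s"
  have b: "1 < b" "b < 4"
    using s powr_less_mono [of s 2 2] by (auto simp: b_def)
  obtain T where T: "0 \<le> T" "\<And>n. (\<Sum>k=1..n. exp (- T * b ^ k)) \<le> \<epsilon> / 2"
    using sum_exp_neg_power_small [of b "\<epsilon> / 2"] b \<epsilon> by auto
  define K where "K = sqrt (32 * A * (C + T)) / (1 - sqrt b / 2) + 2 * sqrt A"
  have "\<exists>E\<in>events. prob E \<le> \<epsilon> \<and> (\<forall>\<omega>\<in>space M - E. \<forall>q\<in>cball m \<rho>.
       (\<Sum>i=1..n. h q (Ys i \<omega>)) \<le> K * \<rho> * sqrt n)"
    if \<rho>: "0 < \<rho>" "\<rho> < min R0 1" and n: "0 < n" for \<rho> n
  proof -
    have sub: "cball m \<rho> \<subseteq> cball m 1" using \<rho> by auto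
    obtain N :: "nat \<Rightarrow> 'p set" where N: "\<And>k. finite (N k)" "\<And>k. N k \<subseteq> cball m \<rho>" "N 0 = {m}"
      "\<And>k x. x \<in> cball m \<rho> \<Longrightarrow> \<exists>y\<in>N k. dist x y \<le> 2 * \<rho> / 2 ^ k"
      "\<And>k. 0 < k \<Longrightarrow> card (N k) \<le> exp (C * b ^ k)"
      unfolding b_def using multiscale_nets [OF nets, of \<rho> m] \<rho> by auto
    have "\<exists>E\<in>events.
      prob E \<le> prob {\<omega> \<in> space M. A * n < (\<Sum>i=1..n. (G (Ys i \<omega>))\<^sup>2)} + (\<Sum>k=1..n. exp (- T * b ^ k)) \<and>
      (\<forall>\<omega>\<in>space M - E. \<forall>q\<in>cball m \<rho>. (\<Sum>i=1..n. h q (Ys i \<omega>)) \<le> \<rho> * sqrt n * K)"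
      unfolding K_def
    proof (rule chaining_tail_bound [where S = borel and N = N and m = m])
      show "indep_vars (\<lambda>_. borel) Ys {1..n}" by (rule indep_vars_subset [OF indep]) auto
      show "expectation (\<lambda>\<omega>. (G (Ys i \<omega>))\<^sup>2) \<le> A" if "i \<in> {1..n}" for i
        using transfer(1) [OF _ G2, of i] that A by (simp add: V_def)
      show "integrable M (\<lambda>\<omega>. (G (Ys i \<omega>))\<^sup>2)" if "i \<in> {1..n}" for i
        using transfer(2) [OF _ G2, of i] that G_int by simp
      show "h m y = 0" for y using base by (simp add: h_def)
      show "\<bar>h p y - h q y\<bar> \<le> dist p q * G y" if "p \<in> cball m \<rho>" "q \<in> cball m \<rho>" for p q y
        using h_lip that sub by blast
      show "integrable M (\<lambda>\<omega>. h p (Ys i \<omega>))" "expectation (\<lambda>\<omega>. h p (Ys i \<omega>)) = 0"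
        if "p \<in> cball m \<rho>" "i \<in> {1..n}" for p i
        using h_centred [of p i] that sub by auto
    qed (use n h G G_nonneg N A C T b \<rho> in auto)
    then obtain E where E: "E \<in> events"
      "prob E \<le> prob {\<omega> \<in> space M. A * n < (\<Sum>i=1..n. (G (Ys i \<omega>))\<^sup>2)} + (\<Sum>k=1..n. exp (- T * b ^ k))"
      "\<forall>\<omega>\<in>space M - E. \<forall>q\<in>cball m \<rho>. (\<Sum>i=1..n. h q (Ys i \<omega>)) \<le> \<rho> * sqrt n * K" by blast
    have "prob {\<omega> \<in> space M. A * n < (\<Sum>i=1..n. (G (Ys i \<omega>))\<^sup>2)} \<le> \<epsilon> / 2"
    proof -
      define S where "S \<omega> = (\<Sum>i=1..n. (G (Ys i \<omega>))\<^sup>2)" for \<omega>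
      have S_int: "integrable M S"
        using transfer(2) [OF _ G2] G_int
        unfolding S_def by (intro Bochner_Integration.integrable_sum) simp
      have S_meas [measurable]: "S \<in> borel_measurable M"
        using S_int by (rule borel_measurable_integrable)
      have "prob {\<omega> \<in> space M. A * n < S \<omega>} \<le> prob {\<omega> \<in> space M. A * n \<le> S \<omega>}"
        by (rule finite_measure_mono) (blast intro: less_imp_le, measurable)
      also have "\<dots> \<le> expectation S / (A * n)"
      proof (rule integral_Markov_inequality_measure [OF S_int, where A = "{}"])
        show "AE \<omega> in M. 0 \<le> S \<omega>" unfolding S_def by (intro AE_I2 sum_nonneg) simp
      qed (use A n in auto)
      also have "expectation S = (\<Sum>i=1..n. expectation (\<lambda>\<omega>. (G (Ys i \<omega>))\<^sup>2))"
        unfolding S_def using transfer(2) [OF _ G2] G_int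
        by (intro Bochner_Integration.integral_sum) simp
      also have "\<dots> = (\<Sum>i=1..n. V)"
        unfolding V_def by (intro sum.cong refl transfer(1) [OF _ G2]) simp
      also have "(\<Sum>i=1..n. V) / (A * n) = V / A" using n by simp
      also have "\<dots> \<le> \<epsilon> / 2" using A \<epsilon> by (simp add: field_simps)
      finally show ?thesis by (simp add: S_def)
    qed
    with E(2) T(2) [of n] have "prob E \<le> \<epsilon>" by linarith
    with E show ?thesis by (intro bexI [of _ E] conjI) (auto simp: mult_ac)
  qed
  then show ?thesis unfolding h_def
    using R0 by (intro exI [of _ K] exI [of _ "min R0 1"] conjI allI impI) simp_all
qed

end

section \<open>The rate of convergence\<close>

theorem corollary5p4:
  fixes M :: "'w measure"
    and Y :: "'w \<Rightarrow> 'a::hadamard_space"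
    and Ys :: "nat \<Rightarrow> 'w \<Rightarrow> 'a"
    and m z :: 'a
    and mn :: "nat \<Rightarrow> 'w \<Rightarrow> 'a"
    and \<alpha> \<beta> :: real
  assumes entropy: "entropy_condition TYPE('a)"
    and alpha: "1 < \<alpha>" "\<alpha> \<le> 2"
    and prob: "prob_space M"
    and Y_measurable: "Y \<in> borel_measurable M"
    and Y_separable: "concentrated_on_separable M Y"
    and Y_moment: "integrable M (\<lambda>\<omega>. dist (Y \<omega>) z powr (\<alpha> - 1))"
    and m_mean: "is_frechet_mean \<alpha> M Y z m"
    and Ys_indep: "prob_space.indep_vars M (\<lambda>_. borel) Ys {1..}"
    and Ys_copies: "\<And>j. j \<ge> 1 \<Longrightarrow> distr M borel (Ys j) = distr M borel Y"
    and mn_measurable: "\<And>n. n \<ge> 1 \<Longrightarrow> mn n \<in> borel_measurable M"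
    and mn_mean: "\<And>n. n \<ge> 1 \<Longrightarrow>
      AE \<omega> in M. is_empirical_frechet_mean \<alpha> n (\<lambda>j. Ys j \<omega>) (mn n \<omega>)"
    and sigma: "integrable M (\<lambda>\<omega>. dist (Y \<omega>) m powr (2 * \<alpha> - 2))"
    and beta: "\<beta> = 2 \<or>
      (\<alpha> \<le> \<beta> \<and> \<beta> < 2 \<and>
       Liminf (at_right 0)
         (\<lambda>t. ereal (t powr (\<alpha> - \<beta>) * measure M {\<omega>\<in>space M. dist (Y \<omega>) m \<le> t})) > 0)"
  shows "bigO_prob M (\<lambda>n \<omega>. dist m (mn n \<omega>)) (\<lambda>n. real n powr (- 1 / (2 * (\<beta> - 1))))"
proof -
  interpret prob_space M by (rule prob)
  note [measurable] = Y_measurable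
  have \<beta>: "1 < \<beta>" using beta alpha by auto
  define f where "f q y = dist y q powr \<alpha> - dist y m powr \<alpha>" for q y
  define F where "F y = \<alpha> * (dist y m + 1) powr (\<alpha> - 1)" for y
  define rate where "rate n = real n powr (- 1 / (2 * (\<beta> - 1)))" for n
  have f [measurable]: "f q \<in> borel_measurable borel" for q unfolding f_def by measurable
  have F [measurable]: "F \<in> borel_measurable borel" unfolding F_def by measurable
  have F_int: "integrable M (\<lambda>\<omega>. (F (Y \<omega>))\<^sup>2)"
  proof (rule Bochner_Integration.integrable_bound)
    let ?g = "\<lambda>y. \<alpha>\<^sup>2 * (2 powr (2 * \<alpha> - 2) * (dist y m powr (2 * \<alpha> - 2) + 1))"
    show "integrable M (\<lambda>\<omega>. ?g (Y \<omega>))" using sigma by simp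
    have "(F y)\<^sup>2 \<le> ?g y" for y
    proof -
      have "(F y)\<^sup>2 = \<alpha>\<^sup>2 * (dist y m + 1) powr (2 * \<alpha> - 2)"
      proof -
        have "((dist y m + 1) powr (\<alpha> - 1))\<^sup>2 = (dist y m + 1) powr ((\<alpha> - 1) + (\<alpha> - 1))"
          by (simp only: power2_eq_square powr_add)
        also have "(\<alpha> - 1) + (\<alpha> - 1) = 2 * \<alpha> - 2" by simp
        finally show ?thesis by (simp only: F_def power_mult_distrib)
      qed
      also have "\<dots> \<le> ?g y"
        using powr_add_le [of "dist y m" 1 "2 * \<alpha> - 2"] alpha by (intro mult_left_mono) auto
      finally show ?thesis .
    qed
    then show "AE \<omega> in M. norm ((F (Y \<omega>))\<^sup>2) \<le> norm (?g (Y \<omega>))"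
      by (intro AE_I2) (simp add: order_trans [OF _ abs_ge_self])
  qed measurable
  have f_lipschitz: "\<bar>f p y - f q y\<bar> \<le> dist p q * F y" if "p \<in> cball m 1" "q \<in> cball m 1" for p q y
  proof -
    have "\<bar>f p y - f q y\<bar> = \<bar>dist y p powr \<alpha> - dist y q powr \<alpha>\<bar>" by (simp add: f_def)
    also have "\<dots> \<le> \<alpha> * \<bar>dist y p - dist y q\<bar> * (dist y m + 1) powr (\<alpha> - 1)"
      using that alpha dist_triangle [of y p m] dist_triangle [of y q m]
      by (intro abs_powr_diff_le) auto
    also have "\<dots> \<le> \<alpha> * dist p q * (dist y m + 1) powr (\<alpha> - 1)"
      using alpha abs_dist_diff_le [of p y q]
      by (intro mult_right_mono mult_left_mono) (auto simp: dist_commute)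
    finally show ?thesis by (simp add: F_def mult_ac)
  qed
  obtain c r where c: "0 < c" and r: "0 < r"
    and growth: "\<And>q. dist m q < r \<Longrightarrow> c * dist m q powr \<beta> \<le> expectation (\<lambda>\<omega>. f q (Y \<omega>))"
    using frechet_mean_growth [OF Y_measurable alpha Y_moment m_mean beta] unfolding f_def by blast
  have localize: "\<exists>p. \<rho> / 2 < dist m p \<and> dist m p \<le> \<rho> \<and> (\<Sum>j=1..n. f p (Ys j \<omega>)) \<le> 0"
    if mean: "is_empirical_frechet_mean \<alpha> n (\<lambda>j. Ys j \<omega>) (mn n \<omega>)"
      and far: "\<rho> < dist m (mn n \<omega>)" and \<rho>: "0 < \<rho>" for n \<omega> \<rho>
  proof -
    define \<phi> where "\<phi> q = (\<Sum>j=1..n. dist (Ys j \<omega>) q powr \<alpha>)" for q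
    have "\<phi> p \<le> (\<phi> m + \<phi> q) / 2" if "is_midpoint m q p" for p q
    proof -
      have "\<phi> p \<le> (\<Sum>j=1..n. (dist (Ys j \<omega>) m powr \<alpha> + dist (Ys j \<omega>) q powr \<alpha>) / 2)"
        unfolding \<phi>_def
      proof (rule sum_mono)
        fix j
        show "dist (Ys j \<omega>) p powr \<alpha> \<le> (dist (Ys j \<omega>) m powr \<alpha> + dist (Ys j \<omega>) q powr \<alpha>) / 2"
          using alpha by (intro order_trans [OF _ powr_dist_midpoint_le [OF that alpha]]) simp
      qed
      also have "\<dots> = (\<phi> m + \<phi> q) / 2"
        by (simp add: \<phi>_def sum.distrib sum_divide_distrib [symmetric])
      finally show ?thesis .
    qed
    moreover have "\<phi> (mn n \<omega>) \<le> \<phi> m"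
      using mean by (auto simp: is_empirical_frechet_mean_def is_arg_min_linorder \<phi>_def)
    ultimately obtain p where "\<rho> / 2 < dist m p" "dist m p \<le> \<rho>" "\<phi> p \<le> \<phi> m"
      using midpoint_convex_localize [of m \<phi>] far \<rho> by blast
    then show ?thesis by (intro exI [of _ p]) (simp add: f_def \<phi>_def sum_subtractf)
  qed
  have tail: "\<exists>t0. \<forall>t>t0. limsup (\<lambda>n. ereal (prob {\<omega> \<in> space M. dist m (mn n \<omega>) > t * rate n})) \<le> ereal \<epsilon>"
    if \<epsilon>: "0 < \<epsilon>" for \<epsilon>
  proof -
    have "\<exists>K. \<exists>R>0. \<forall>\<rho> n. 0 < \<rho> \<longrightarrow> \<rho> < R \<longrightarrow> 0 < n \<longrightarrow> (\<exists>E\<in>events. prob E \<le> \<epsilon> \<and>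
        (\<forall>\<omega>\<in>space M - E. \<forall>q\<in>cball m \<rho>.
          (\<Sum>i=1..n. expectation (\<lambda>\<omega>. f q (Y \<omega>)) - f q (Ys i \<omega>)) \<le> K * \<rho> * sqrt n))"
    proof (rule local_empirical_process_bound [OF entropy Y_measurable Ys_indep Ys_copies
          f F _ F_int f_lipschitz _ \<epsilon>])
      show "0 \<le> F y" for y using alpha by (simp add: F_def)
      show "f m y = 0" for y by (simp add: f_def)
    qed
    then obtain K R where R: "0 < R" and sup:
      "\<forall>\<rho> n. 0 < \<rho> \<longrightarrow> \<rho> < R \<longrightarrow> 0 < n \<longrightarrow> (\<exists>E\<in>events. prob E \<le> \<epsilon> \<and>
        (\<forall>\<omega>\<in>space M - E. \<forall>q\<in>cball m \<rho>.
          (\<Sum>i=1..n. expectation (\<lambda>\<omega>. f q (Y \<omega>)) - f q (Ys i \<omega>)) \<le> K * \<rho> * sqrt n))"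
      by (elim exE conjE) (rule that)
    \<comment> \<open>beyond \<open>t0\<close> the growth constant wins: \<open>K 2\<^sup>\<beta> < c t\<^sup>\<beta>\<^sup>-\<^sup>1\<close>\<close>
    define t0 where "t0 = max 1 ((\<bar>K\<bar> * 2 powr \<beta> / c) powr (1 / (\<beta> - 1)))"
    have "limsup (\<lambda>n. ereal (prob {\<omega> \<in> space M. dist m (mn n \<omega>) > t * rate n})) \<le> ereal \<epsilon>"
      if t: "t0 < t" for t
    proof (rule Limsup_bounded)
      have t_pos: "0 < t" using t by (simp add: t0_def)
      have t_large: "K * 2 powr \<beta> < c * t powr (\<beta> - 1)"
      proof -
        have "(\<bar>K\<bar> * 2 powr \<beta> / c) powr (1 / (\<beta> - 1)) < t" using t by (simp add: t0_def)
        then have "((\<bar>K\<bar> * 2 powr \<beta> / c) powr (1 / (\<beta> - 1))) powr (\<beta> - 1) < t powr (\<beta> - 1)"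
          using \<beta> by (intro powr_less_mono2) auto
        then have "\<bar>K\<bar> * 2 powr \<beta> / c < t powr (\<beta> - 1)" using \<beta> c by (simp add: powr_powr)
        then have "\<bar>K\<bar> * 2 powr \<beta> < c * t powr (\<beta> - 1)" using c by (simp add: field_simps)
        moreover have "K * 2 powr \<beta> \<le> \<bar>K\<bar> * 2 powr \<beta>" by (intro mult_right_mono) auto
        ultimately show ?thesis by linarith
      qed
      have "(\<lambda>n. t * rate n) \<longlonglongrightarrow> t * 0"
        unfolding rate_def using \<beta>
        by (intro tendsto_mult tendsto_const tendsto_neg_powr filterlim_real_sequentially)
          (simp add: divide_neg_pos)
      then have "eventually (\<lambda>n. t * rate n < min R r) sequentially"
        using R r by (intro order_tendstoD(2) [of _ "t * 0"]) auto
      then show "\<forall>\<^sub>F n in sequentially. ereal (prob {\<omega> \<in> space M. dist m (mn n \<omega>) > t * rate n}) \<le> ereal \<epsilon>"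
        using eventually_gt_at_top [of 0]
      proof eventually_elim
        case (elim n)
        define \<rho> where "\<rho> = t * rate n"
        have \<rho>: "0 < \<rho>" "\<rho> < R" "\<rho> < r" using elim t_pos by (auto simp: \<rho>_def rate_def)
        \<comment> \<open>the rate is chosen so that this product does not depend on \<open>n\<close>\<close>
        have balance: "sqrt n * \<rho> powr (\<beta> - 1) = t powr (\<beta> - 1)"
        proof -
          have "rate n powr (\<beta> - 1) = real n powr (- (1 / 2))"
          proof -
            have "- 1 / (2 * (\<beta> - 1)) * (\<beta> - 1) = - (1 / 2)" using \<beta> by simp
            then show ?thesis by (simp only: rate_def powr_powr)
          qed
          moreover have "sqrt n * real n powr (- (1 / 2)) = 1"
            using elim(2) by (simp add: powr_minus powr_half_sqrt)
          moreover have "\<rho> powr (\<beta> - 1) = t powr (\<beta> - 1) * rate n powr (\<beta> - 1)"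
            using t_pos by (simp add: \<rho>_def powr_mult rate_def)
          ultimately show ?thesis by (metis mult.commute mult.left_commute mult_1)
        qed
        obtain E where E: "E \<in> events" "prob E \<le> \<epsilon>"
          "\<forall>\<omega>\<in>space M - E. \<forall>q\<in>cball m \<rho>.
            (\<Sum>i=1..n. expectation (\<lambda>\<omega>. f q (Y \<omega>)) - f q (Ys i \<omega>)) \<le> K * \<rho> * sqrt n"
          using sup [rule_format, OF \<rho>(1,2) elim(2)] by (elim bexE conjE) (rule that)
        have close: "\<omega> \<in> E" if \<omega>: "\<omega> \<in> space M" "dist m (mn n \<omega>) > \<rho>"
          "is_empirical_frechet_mean \<alpha> n (\<lambda>j. Ys j \<omega>) (mn n \<omega>)" for \<omega>
        proof (rule ccontr)
          assume "\<omega> \<notin> E"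
          obtain p where p: "\<rho> / 2 < dist m p" "dist m p \<le> \<rho>" "(\<Sum>j=1..n. f p (Ys j \<omega>)) \<le> 0"
            using localize [OF \<omega>(3,2) \<rho>(1)] by blast
          have "n * (c * (\<rho> / 2) powr \<beta>) \<le> n * (c * dist m p powr \<beta>)"
            using p \<rho> c \<beta> by (intro mult_left_mono powr_mono2) auto
          also have "\<dots> \<le> n * expectation (\<lambda>\<omega>. f p (Y \<omega>))"
            using growth [of p] p \<rho> by (intro mult_left_mono) auto
          also have "\<dots> \<le> (\<Sum>i=1..n. expectation (\<lambda>\<omega>. f p (Y \<omega>)) - f p (Ys i \<omega>))"
            using p by (simp add: sum_subtractf)
          also have "\<dots> \<le> K * \<rho> * sqrt n"
            using E(3) \<omega>(1) \<open>\<omega> \<notin> E\<close> p(2) by simp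
          finally have *: "n * (c * (\<rho> / 2) powr \<beta>) \<le> K * \<rho> * sqrt n" .
          have "n * (c * (\<rho> / 2) powr \<beta>) = \<rho> * sqrt n / 2 powr \<beta> * (c * t powr (\<beta> - 1))"
          proof -
            have "\<rho> powr \<beta> = \<rho> * \<rho> powr (\<beta> - 1)" using \<rho> by (simp add: powr_mult_base)
            then have "n * (c * (\<rho> / 2) powr \<beta>)
                = (sqrt n * sqrt n) * (c * (\<rho> * \<rho> powr (\<beta> - 1) / 2 powr \<beta>))"
              using \<rho> by (simp add: powr_divide)
            also have "\<dots> = \<rho> * sqrt n / 2 powr \<beta> * (c * (sqrt n * \<rho> powr (\<beta> - 1)))"
              by (simp only: mult_ac times_divide_eq_left times_divide_eq_right)
            finally show ?thesis by (simp only: balance)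
          qed
          moreover have "\<rho> * sqrt n / 2 powr \<beta> * (K * 2 powr \<beta>) < \<rho> * sqrt n / 2 powr \<beta> * (c * t powr (\<beta> - 1))"
            using \<rho> elim(2) t_large by (intro mult_strict_left_mono) auto
          moreover have "\<rho> * sqrt n / 2 powr \<beta> * (K * 2 powr \<beta>) = K * \<rho> * sqrt n" by simp
          ultimately show False using * by linarith
        qed
        have "AE \<omega> in M. \<omega> \<in> {\<omega> \<in> space M. dist m (mn n \<omega>) > \<rho>} \<longrightarrow> \<omega> \<in> E"
        proof -
          have "AE \<omega> in M. is_empirical_frechet_mean \<alpha> n (\<lambda>j. Ys j \<omega>) (mn n \<omega>)"
            using elim(2) by (intro mn_mean) simp
          with AE_space show ?thesis by eventually_elim (use close in simp)
        qed
        then have "prob {\<omega> \<in> space M. dist m (mn n \<omega>) > \<rho>} \<le> prob E"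
          using E(1) by (rule finite_measure_mono_AE)
        with E(2) show ?case by (simp add: \<rho>_def)
      qed
    qed
    then show ?thesis by blast
  qed
  let ?L = "\<lambda>t. limsup (\<lambda>n. ereal (prob {\<omega> \<in> space M. dist m (mn n \<omega>) > t * rate n}))"
  have "(?L \<longlongrightarrow> 0) at_top"
  proof (rule order_tendstoI)
    fix a :: ereal
    assume "a < 0"
    moreover have "0 \<le> ?L t" for t
      by (rule le_Limsup) auto
    ultimately show "\<forall>\<^sub>F t in at_top. a < ?L t" by (simp add: less_le_trans)
  next
    fix a :: ereal
    assume "0 < a"
    then obtain \<epsilon> where \<epsilon>: "0 < ereal \<epsilon>" "ereal \<epsilon> < a" using ereal_dense2 by blast
    then obtain t0 where "\<forall>t>t0. ?L t \<le> ereal \<epsilon>" using tail [of \<epsilon>] by auto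
    with \<epsilon> show "\<forall>\<^sub>F t in at_top. ?L t < a"
      by (intro eventually_mono [OF eventually_gt_at_top [of t0]]) (auto intro: le_less_trans)
  qed
  then show ?thesis by (simp add: bigO_prob_def rate_def)
qed

end
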